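(* Let $Q=(Q_0,Q_1)$ be a finite acyclic quiver with nonempty vertex set, let $\Bbbk$ be a commutative ring with unit, and let $\prec$ be a total order on $Q_0$ such that $s(\alpha)\prec t(\alpha)$ for every arrow $\alpha\in Q_1$. Then $B_Q^{\prec}$ (with the multiplication of $\Bbbk Q$) is a left regular band, and $\Bbbk B_Q^{\prec}=\Bbbk Q$, i.e. the inclusion $B_Q^{\prec}\subseteq\Bbbk Q$ extends linearly to an isomorphism of $\Bbbk$-algebras from the monoid algebra $\Bbbk B_Q^{\prec}$ to the path algebra $\Bbbk Q$.
   Context: A left regular band is a monoid satisfying $x^2=x$ and $xyx=xy$ for all elements $x,y$. For an arrow $\alpha$, $s(\alpha)$ and $t(\alpha)$ are its source and target. A path of length $n\geq 1$ is a sequence $(\alpha_1\cdots\alpha_n)$ of arrows with $t(\alpha_i)=s(\alpha_{i+1})$ for $1\le i<n$; for each vertex $v$ there is also a stationary path $\varepsilon_v$ of length $0$ with source and target $v$. The path algebra $\Bbbk Q$ is the free $\Bbbk$-module on all paths; the product of two paths $(\alpha_1\cdots\alpha_r)(\beta_1\cdots\beta_s)$ is the concatenation $(\alpha_1\cdots\alpha_r\beta_1\cdots\beta_s)$ if the target of the first equals the source of the second, and $0$ otherwise; in particular $\varepsilon_v\varepsilon_u=\delta_{u,v}\varepsilon_v$. For a path $(\alpha_1\cdots\alpha_n)$ put $$\ell(\alpha_1\cdots\alpha_n)=\sum_{u\succeq t(\alpha_n)}\varepsilon_u+\sum_{i=1}^n(\alpha_i\cdots\alpha_n)\in\Bbbk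 Q,$$ where for a stationary path $\varepsilon_v$ (the case $n=0$) $t(\alpha_n)$ is understood to be $v$, so $\ell(\varepsilon_v)=\sum_{u\succeq v}\varepsilon_u$. Let $B_Q^{\prec}=\{\ell(p)\mid p \text{ a path of } Q\}\subseteq\Bbbk Q$. *)

theory Defs
  imports "Graph_Theory.Arc_Walk" "HOL-Algebra.Module" "HOL-Algebra.QuotRing"
begin

section \<open>Left regular bands\<close>

locale left_regular_band = monoid +
  assumes idem: "x \<in> carrier G \<Longrightarrow> x \<otimes> x = x"
    and left_regular:
      "\<lbrakk>x \<in> carrier G; y \<in> carrier G\<rbrakk> \<Longrightarrow> x \<otimes> y \<otimes> x = x \<otimes> y"

section \<open>Unital associative algebras over a commutative ring\<close>

text \<open>The locale \<^locale>\<open>algebra\<close> of HOL-Algebra is restricted to commutative algebras.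
  As usual in HOL-Algebra, \<^locale>\<open>cring\<close> admits the zero ring.\<close>

locale assoc_algebra = Module.module R A + A?: ring A for R (structure) and A (structure) +
  assumes smult_mult_left:
      "\<lbrakk>a \<in> carrier R; x \<in> carrier A; y \<in> carrier A\<rbrakk>
        \<Longrightarrow> (a \<odot>\<^bsub>A\<^esub> x) \<otimes>\<^bsub>A\<^esub> y = a \<odot>\<^bsub>A\<^esub> (x \<otimes>\<^bsub>A\<^esub> y)"
    and smult_mult_right:
      "\<lbrakk>a \<in> carrier R; x \<in> carrier A; y \<in> carrier A\<rbrakk>
        \<Longrightarrow> x \<otimes>\<^bsub>A\<^esub> (a \<odot>\<^bsub>A\<^esub> y) = a \<odot>\<^bsub>A\<^esub> (x \<otimes>\<^bsub>A\<^esub> y)"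

locale assoc_algebra_iso = A: assoc_algebra R A + B: assoc_algebra R B
  for R (structure) and A (structure) and B (structure) +
  fixes h
  assumes ring_iso: "h \<in> ring_iso A B"
    and map_smult: "\<lbrakk>a \<in> carrier R; x \<in> carrier A\<rbrakk> \<Longrightarrow> h (a \<odot>\<^bsub>A\<^esub> x) = a \<odot>\<^bsub>B\<^esub> h x"

section \<open>Algebras with a multiplicative basis\<close>

text \<open>The free module on a set \<open>X\<close>, realised as the finitely supported functions from \<open>X\<close>
  to the ring. Its product extends bilinearly a partial operation \<open>m\<close> on \<open>X\<close>, where
  \<open>m x y = None\<close> stands for the product \<open>0\<close>. The unit is the sum of the finitely many
  basis elements in \<open>E\<close>.\<close>

definition basis_algebra ::
  "('k, 'r) ring_scheme \<Rightarrow> 'x set \<Rightarrow> ('x \<Rightarrow> 'x \<Rightarrow> 'x option) \<Rightarrow> 'x set \<Rightarrow> ('k, 'x \<Rightarrow> 'k) module"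
  where "basis_algebra R X m E =
   \<lparr>carrier = {f \<in> X \<rightarrow>\<^sub>E carrier R. finite {x \<in> X. f x \<noteq> \<zero>\<^bsub>R\<^esub>}},
    monoid.mult = (\<lambda>f g. \<lambda>z\<in>X. finsum R (\<lambda>(x, y). f x \<otimes>\<^bsub>R\<^esub> g y)
              {(x, y). x \<in> X \<and> y \<in> X \<and> f x \<noteq> \<zero>\<^bsub>R\<^esub> \<and> g y \<noteq> \<zero>\<^bsub>R\<^esub> \<and> m x y = Some z}),
    one = (\<lambda>x\<in>X. if x \<in> E then \<one>\<^bsub>R\<^esub> else \<zero>\<^bsub>R\<^esub>),
    ring.zero = (\<lambda>x\<in>X. \<zero>\<^bsub>R\<^esub>),
    add = (\<lambda>f g. \<lambda>x\<in>X. f x \<oplus>\<^bsub>R\<^esub> g x),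
    smult = (\<lambda>a f. \<lambda>x\<in>X. a \<otimes>\<^bsub>R\<^esub> f x)\<rparr>"

definition basis_vector :: "('k, 'r) ring_scheme \<Rightarrow> 'x set \<Rightarrow> 'x \<Rightarrow> 'x \<Rightarrow> 'k"
  where "basis_vector R X x = (\<lambda>y\<in>X. if y = x then \<one>\<^bsub>R\<^esub> else \<zero>\<^bsub>R\<^esub>)"

definition monoid_algebra ::
  "('k, 'r) ring_scheme \<Rightarrow> ('x, 'm) monoid_scheme \<Rightarrow> ('k, 'x \<Rightarrow> 'k) module"
  where "monoid_algebra R M =
    basis_algebra R (carrier M) (\<lambda>x y. Some (x \<otimes>\<^bsub>M\<^esub> y)) {\<one>\<^bsub>M\<^esub>}"

text \<open>The linear map from the free module on \<open>X\<close> to \<open>A\<close> which sends each basis element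
  \<open>x\<close> to \<open>\<phi> x\<close>.\<close>

definition linear_extension ::
  "('k, 'r) ring_scheme \<Rightarrow> 'x set \<Rightarrow> ('k, 'a, 's) module_scheme \<Rightarrow> ('x \<Rightarrow> 'a) \<Rightarrow> ('x \<Rightarrow> 'k) \<Rightarrow> 'a"
  where "linear_extension R X A \<phi> f =
    (\<Oplus>\<^bsub>A\<^esub>x\<in>{x \<in> X. f x \<noteq> \<zero>\<^bsub>R\<^esub>}. f x \<odot>\<^bsub>A\<^esub> \<phi> x)"

section \<open>Path algebras\<close>

text \<open>A quiver is a directed multigraph: \<^const>\<open>tail\<close> and \<^const>\<open>head\<close> are the source and target
  maps. A path is encoded by its source and its list of arrows, so that \<open>(v, [])\<close> is the stationary
  path at \<open>v\<close>.\<close>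

type_synonym ('v, 'e) path = "'v \<times> 'e list"

definition quiver_paths :: "('v, 'e) pre_digraph \<Rightarrow> ('v, 'e) path set"
  where "quiver_paths Q = {(u, as). \<exists>v. pre_digraph.awalk Q u as v}"

definition path_target :: "('v, 'e) pre_digraph \<Rightarrow> ('v, 'e) path \<Rightarrow> 'v"
  where "path_target Q p = (if snd p = [] then fst p else head Q (last (snd p)))"

definition path_concat ::
  "('v, 'e) pre_digraph \<Rightarrow> ('v, 'e) path \<Rightarrow> ('v, 'e) path \<Rightarrow> ('v, 'e) path option"
  where "path_concat Q p q =
    (if path_target Q p = fst q then Some (fst p, snd p @ snd q) else None)"

definition path_algebra ::
  "('k, 'r) ring_scheme \<Rightarrow> ('v, 'e) pre_digraph \<Rightarrow> ('k, ('v, 'e) path \<Rightarrow> 'k) module"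
  where "path_algebra R Q =
    basis_algebra R (quiver_paths Q) (path_concat Q) ((\<lambda>v. (v, [])) ` verts Q)"

abbreviation path_vector ::
  "('k, 'r) ring_scheme \<Rightarrow> ('v, 'e) pre_digraph \<Rightarrow> ('v, 'e) path \<Rightarrow> ('v, 'e) path \<Rightarrow> 'k"
  where "path_vector R Q \<equiv> basis_vector R (quiver_paths Q)"

section \<open>The band of a quiver\<close>

text \<open>With arrows indexed from \<open>0\<close>, the path \<open>(tail Q (as ! i), drop i as)\<close> is
  \<open>\<alpha>\<^sub>i \<cdots> \<alpha>\<^sub>n\<close>. The relation \<open>prec\<close> is the strict order, so the first sum is over
  the vertices weakly above the target of the path.\<close>

definition ell ::
  "('k, 'r) ring_scheme \<Rightarrow> ('v, 'e) pre_digraph \<Rightarrow> 'v rel \<Rightarrow> ('v, 'e) path \<Rightarrow> ('v, 'e) path \<Rightarrow> 'k"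
  where "ell R Q prec p =
    (\<Oplus>\<^bsub>path_algebra R Q\<^esub>u\<in>{u \<in> verts Q. u = path_target Q p \<or> (path_target Q p, u) \<in> prec}.
        path_vector R Q (u, []))
    \<oplus>\<^bsub>path_algebra R Q\<^esub>
    (\<Oplus>\<^bsub>path_algebra R Q\<^esub>i\<in>{..<length (snd p)}.
        path_vector R Q (tail Q (snd p ! i), drop i (snd p)))"

definition quiver_band_set ::
  "('k, 'r) ring_scheme \<Rightarrow> ('v, 'e) pre_digraph \<Rightarrow> 'v rel \<Rightarrow> (('v, 'e) path \<Rightarrow> 'k) set"
  where "quiver_band_set R Q prec = ell R Q prec ` quiver_paths Q"

text \<open>This only replaces the carrier of the path algebra: product and unit are inherited from it.\<close>

definition quiver_band ::
  "('k, 'r) ring_scheme \<Rightarrow> ('v, 'e) pre_digraph \<Rightarrow> 'v rel \<Rightarrow> ('k, ('v, 'e) path \<Rightarrow> 'k) module"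
  where "quiver_band R Q prec = (path_algebra R Q)\<lparr>carrier := quiver_band_set R Q prec\<rparr>"

end

theory Submission
  imports Defs
begin

text \<open>
  Every coefficient of \<open>\<ell>(p)\<close> is \<open>0\<close> or \<open>1\<close>, and the paths occurring in \<open>\<ell>(p)\<close> have pairwise
  distinct sources. Hence in a product \<open>\<ell>(p) \<ell>(q)\<close> no two composable pairs have the same
  concatenation, and the product is again the sum over a set of paths. That set is the one of \<open>p\<close>
  if the target of \<open>q\<close> lies weakly below the target of \<open>p\<close>, and otherwise the one of some path with
  the same target as \<open>q\<close>. So the target of \<open>\<ell>(p) \<ell>(q)\<close> lies weakly above that of \<open>p\<close>, and
  absorption gives both \<open>x x = x\<close> and \<open>x y x = x y\<close>. The band is a basis because passing from a
  path \<open>p\<close> to the other paths in \<open>\<ell>(p)\<close> either shortens the path or, for stationary paths, moves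
  the vertex up: the transition matrix is unitriangular. Over the zero ring all \<open>\<ell>(p)\<close> coincide,
  but then both algebras are trivial.
\<close>

section \<open>Finite sums\<close>

context abelian_monoid
begin

lemma finsum_Sigma:
  assumes "finite A" "\<And>x. x \<in> A \<Longrightarrow> finite (B x)"
    and "\<And>x y. \<lbrakk>x \<in> A; y \<in> B x\<rbrakk> \<Longrightarrow> f x y \<in> carrier G"
  shows "(\<Oplus>x\<in>A. \<Oplus>y\<in>B x. f x y) = (\<Oplus>p\<in>Sigma A B. f (fst p) (snd p))"
proof -
  have "(\<Oplus>p\<in>Sigma A B. f (fst p) (snd p)) = (\<Oplus>p\<in>(\<Union>x\<in>A. Pair x ` B x). f (fst p) (snd p))"
    by (rule finsum_cong') (use assms in auto)
  also have "\<dots> = (\<Oplus>x\<in>A. \<Oplus>p\<in>Pair x ` B x. f (fst p) (snd p))"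
    using assms by (intro add.finprod_UN_disjoint) (auto simp: pairwise_def disjnt_def)
  also have "\<dots> = (\<Oplus>x\<in>A. \<Oplus>y\<in>B x. f x y)"
  proof (rule finsum_cong'[OF refl])
    fix x assume "x \<in> A"
    then show "(\<Oplus>p\<in>Pair x ` B x. f (fst p) (snd p)) = (\<Oplus>y\<in>B x. f x y)"
      using assms by (subst finsum_reindex) (auto simp: inj_on_def)
  qed (use assms in auto)
  finally show ?thesis by simp
qed

lemma finsum_subset:
  assumes "finite B" "A \<subseteq> B" "\<And>x. x \<in> B \<Longrightarrow> f x \<in> carrier G"
    and "\<And>x. x \<in> B - A \<Longrightarrow> f x = \<zero>"
  shows "(\<Oplus>x\<in>A. f x) = (\<Oplus>x\<in>B. f x)"
  using assms by (intro add.finprod_mono_neutral_cong_left) auto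

end

section \<open>Algebras with a finite multiplicative basis\<close>

lemma basis_algebra_simps:
  "carrier (basis_algebra R X m E) = {f \<in> X \<rightarrow>\<^sub>E carrier R. finite {x \<in> X. f x \<noteq> \<zero>\<^bsub>R\<^esub>}}"
  "f \<otimes>\<^bsub>basis_algebra R X m E\<^esub> g = (\<lambda>z\<in>X. finsum R (\<lambda>(x, y). f x \<otimes>\<^bsub>R\<^esub> g y)
     {(x, y). x \<in> X \<and> y \<in> X \<and> f x \<noteq> \<zero>\<^bsub>R\<^esub> \<and> g y \<noteq> \<zero>\<^bsub>R\<^esub> \<and> m x y = Some z})"
  "\<one>\<^bsub>basis_algebra R X m E\<^esub> = (\<lambda>x\<in>X. if x \<in> E then \<one>\<^bsub>R\<^esub> else \<zero>\<^bsub>R\<^esub>)"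
  "\<zero>\<^bsub>basis_algebra R X m E\<^esub> = (\<lambda>x\<in>X. \<zero>\<^bsub>R\<^esub>)"
  "f \<oplus>\<^bsub>basis_algebra R X m E\<^esub> g = (\<lambda>x\<in>X. f x \<oplus>\<^bsub>R\<^esub> g x)"
  "a \<odot>\<^bsub>basis_algebra R X m E\<^esub> f = (\<lambda>x\<in>X. a \<otimes>\<^bsub>R\<^esub> f x)"
  by (simp_all add: basis_algebra_def)

text \<open>The axioms describe the composition of a finite category: \<open>E\<close> plays the
  role of the identity morphisms, and associativity in the option type says that both bracketings
  are undefined together. A finite monoid with its unit and the paths of the quiver with the
  stationary paths are the two instances.\<close>

locale finite_multiplicative_basis = cring R for R (structure) +
  fixes X :: "'x set" and m :: "'x \<Rightarrow> 'x \<Rightarrow> 'x option" and E :: "'x set"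
  assumes finite_basis [simp]: "finite X"
    and units_subset: "E \<subseteq> X"
    and mult_closed: "\<lbrakk>x \<in> X; y \<in> X; m x y = Some z\<rbrakk> \<Longrightarrow> z \<in> X"
    and mult_assoc: "\<lbrakk>x \<in> X; y \<in> X; z \<in> X\<rbrakk>
      \<Longrightarrow> Option.bind (m x y) (\<lambda>w. m w z) = Option.bind (m y z) (m x)"
    and ex1_left_unit: "x \<in> X \<Longrightarrow> \<exists>!e. e \<in> E \<and> m e x \<noteq> None"
    and left_unit: "\<lbrakk>e \<in> E; x \<in> X; m e x = Some y\<rbrakk> \<Longrightarrow> y = x"
    and ex1_right_unit: "x \<in> X \<Longrightarrow> \<exists>!e. e \<in> E \<and> m x e \<noteq> None"
    and right_unit: "\<lbrakk>e \<in> E; x \<in> X; m x e = Some y\<rbrakk> \<Longrightarrow> y = x"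
begin

abbreviation A where "A \<equiv> basis_algebra R X m E"

text \<open>The index set in \<open>basis_algebra\<close> depends on where the two factors are
  nonzero. Summing over all factorisations in \<open>X\<close> adds only zero terms, and products of
  different factors then share one index set.\<close>

definition factorisations :: "'x \<Rightarrow> ('x \<times> 'x) set"
  where "factorisations z = {p \<in> X \<times> X. m (fst p) (snd p) = Some z}"

lemma finite_factorisations [simp]: "finite (factorisations z)"
  unfolding factorisations_def by simp

lemma fst_factorisations [simp]: "p \<in> factorisations z \<Longrightarrow> fst p \<in> X"
  and snd_factorisations [simp]: "p \<in> factorisations z \<Longrightarrow> snd p \<in> X"
  by (auto simp: factorisations_def)

section \<open>Ring and module laws, checked coefficientwise\<close>

lemma carrier_A: "carrier A = X \<rightarrow>\<^sub>E carrier R"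
  by (auto simp: basis_algebra_simps)

lemma A_apply_closed [simp]: "\<lbrakk>f \<in> carrier A; x \<in> X\<rbrakk> \<Longrightarrow> f x \<in> carrier R"
  by (auto simp: carrier_A)

lemma A_eqI:
  "\<lbrakk>f \<in> carrier A; g \<in> carrier A; \<And>x. x \<in> X \<Longrightarrow> f x = g x\<rbrakk> \<Longrightarrow> f = g"
  unfolding carrier_A by (rule PiE_ext)

lemma A_mult_apply:
  assumes "f \<in> carrier A" "g \<in> carrier A" "z \<in> X"
  shows "(f \<otimes>\<^bsub>A\<^esub> g) z = (\<Oplus>p\<in>factorisations z. f (fst p) \<otimes> g (snd p))"
proof -
  have "(f \<otimes>\<^bsub>A\<^esub> g) z = (\<Oplus>p\<in>{(x, y). x \<in> X \<and> y \<in> X \<and> f x \<noteq> \<zero> \<and> g y \<noteq> \<zero> \<and> m x y = Some z}.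
    f (fst p) \<otimes> g (snd p))"
    using assms by (simp add: basis_algebra_simps case_prod_beta')
  also have "\<dots> = (\<Oplus>p\<in>factorisations z. f (fst p) \<otimes> g (snd p))"
    by (rule finsum_subset) (use assms in \<open>auto simp: factorisations_def\<close>)
  finally show ?thesis .
qed

lemma A_add_apply: "x \<in> X \<Longrightarrow> (f \<oplus>\<^bsub>A\<^esub> g) x = f x \<oplus> g x"
  and A_smult_apply: "x \<in> X \<Longrightarrow> (a \<odot>\<^bsub>A\<^esub> f) x = a \<otimes> f x"
  and A_zero_apply: "x \<in> X \<Longrightarrow> \<zero>\<^bsub>A\<^esub> x = \<zero>"
  and A_one_apply: "x \<in> X \<Longrightarrow> \<one>\<^bsub>A\<^esub> x = (if x \<in> E then \<one> else \<zero>)"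
  by (simp_all add: basis_algebra_simps)

lemmas A_apply = A_add_apply A_smult_apply A_zero_apply A_one_apply A_mult_apply

lemma A_mult_closed: "\<lbrakk>f \<in> carrier A; g \<in> carrier A\<rbrakk> \<Longrightarrow> f \<otimes>\<^bsub>A\<^esub> g \<in> carrier A"
proof -
  assume fg: "f \<in> carrier A" "g \<in> carrier A"
  have "(f \<otimes>\<^bsub>A\<^esub> g) z \<in> carrier R" if "z \<in> X" for z
    using fg that by (simp add: A_mult_apply Pi_iff)
  moreover have "f \<otimes>\<^bsub>A\<^esub> g \<in> extensional X"
    by (simp add: basis_algebra_simps)
  ultimately show ?thesis
    by (simp add: carrier_A PiE_def Pi_iff)
qed

lemma A_closed:
  "\<zero>\<^bsub>A\<^esub> \<in> carrier A" "\<one>\<^bsub>A\<^esub> \<in> carrier A"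
  "\<lbrakk>f \<in> carrier A; g \<in> carrier A\<rbrakk> \<Longrightarrow> f \<oplus>\<^bsub>A\<^esub> g \<in> carrier A"
  "\<lbrakk>a \<in> carrier R; f \<in> carrier A\<rbrakk> \<Longrightarrow> a \<odot>\<^bsub>A\<^esub> f \<in> carrier A"
  unfolding carrier_A by (auto simp: basis_algebra_simps(2-))

text \<open>Both bracketings expand to the same sum over the triples with total product
  \<open>z\<close>. A triple determines its intermediate product, so \<open>L\<close> and
  \<open>R'\<close> map the triples bijectively onto the nested factorisations on either
  side.\<close>

lemma A_mult_assoc:
  assumes fgh: "f \<in> carrier A" "g \<in> carrier A" "h \<in> carrier A"
  shows "f \<otimes>\<^bsub>A\<^esub> g \<otimes>\<^bsub>A\<^esub> h = f \<otimes>\<^bsub>A\<^esub> (g \<otimes>\<^bsub>A\<^esub> h)"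
proof (rule A_eqI)
  fix z assume z: "z \<in> X"
  define T where "T = {(a, b, c). a \<in> X \<and> b \<in> X \<and> c \<in> X \<and> Option.bind (m a b) (\<lambda>w. m w c) = Some z}"
  define L where "L = (\<lambda>(a, b, c :: 'x). ((the (m a b), c), (a, b)))"
  define R' where "R' = (\<lambda>(a :: 'x, b, c). ((a, the (m b c)), (b, c)))"
  \<comment> \<open>Associativity of the partial product enters here: the triples can be described
    by either bracketing.\<close>
  have T': "T = {(a, b, c). a \<in> X \<and> b \<in> X \<and> c \<in> X \<and> Option.bind (m b c) (m a) = Some z}"
    unfolding T_def by (auto simp: mult_assoc)
  have imageL: "(SIGMA p:factorisations z. factorisations (fst p)) = L ` T"
    unfolding T_def L_def factorisations_def
    by (force simp: Option.bind_eq_Some_conv image_iff intro: mult_closed)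
  have imageR: "(SIGMA p:factorisations z. factorisations (snd p)) = R' ` T"
    unfolding T' R'_def factorisations_def
    by (force simp: Option.bind_eq_Some_conv image_iff intro: mult_closed)
  have inj: "inj_on L T" "inj_on R' T"
    by (auto simp: inj_on_def L_def R'_def)
  have T_closed: "\<And>a b c. (a, b, c) \<in> T \<Longrightarrow> f a \<otimes> g b \<otimes> h c \<in> carrier R"
    using fgh by (auto simp: T_def)
  have "(f \<otimes>\<^bsub>A\<^esub> g \<otimes>\<^bsub>A\<^esub> h) z
      = (\<Oplus>p\<in>factorisations z. \<Oplus>q\<in>factorisations (fst p). f (fst q) \<otimes> g (snd q) \<otimes> h (snd p))"
    using fgh z
    by (simp add: A_mult_apply A_mult_closed, intro finsum_cong'[OF refl])
      (simp_all add: A_mult_apply Pi_iff finsum_ldistr)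
  also have "\<dots> = (\<Oplus>s\<in>L ` T. f (fst (snd s)) \<otimes> g (snd (snd s)) \<otimes> h (snd (fst s)))"
    unfolding imageL[symmetric] using fgh
    by (subst finsum_Sigma) auto
  also have "\<dots> = (\<Oplus>t\<in>T. f (fst t) \<otimes> g (fst (snd t)) \<otimes> h (snd (snd t)))"
    using T_closed inj by (subst finsum_reindex) (auto simp: L_def Pi_iff case_prod_beta')
  also have "\<dots> = (\<Oplus>s\<in>R' ` T. f (fst (fst s)) \<otimes> g (fst (snd s)) \<otimes> h (snd (snd s)))"
    using T_closed inj by (subst finsum_reindex) (auto simp: R'_def Pi_iff case_prod_beta')
  also have "\<dots> = (\<Oplus>p\<in>factorisations z. \<Oplus>q\<in>factorisations (snd p). f (fst p) \<otimes> g (fst q) \<otimes> h (snd q))"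
    unfolding imageR[symmetric] using fgh
    by (subst finsum_Sigma) auto
  also have "\<dots> = (f \<otimes>\<^bsub>A\<^esub> (g \<otimes>\<^bsub>A\<^esub> h)) z"
    using fgh z
    by (simp add: A_mult_apply A_mult_closed, intro finsum_cong'[OF refl])
      (simp_all add: A_mult_apply Pi_iff finsum_rdistr m_assoc cong: finsum_cong)
  finally show "(f \<otimes>\<^bsub>A\<^esub> g \<otimes>\<^bsub>A\<^esub> h) z = (f \<otimes>\<^bsub>A\<^esub> (g \<otimes>\<^bsub>A\<^esub> h)) z" .
qed (use fgh in \<open>simp_all add: A_mult_closed\<close>)

text \<open>Only one factorisation of \<open>z\<close> has its first entry in \<open>E\<close>: its
  second entry must be \<open>z\<close>, and the unit composable with \<open>z\<close> is unique.
  All other terms of the product vanish.\<close>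

lemma A_l_one: assumes f: "f \<in> carrier A" shows "\<one>\<^bsub>A\<^esub> \<otimes>\<^bsub>A\<^esub> f = f"
proof (rule A_eqI)
  fix z assume z: "z \<in> X"
  obtain e where e: "e \<in> E" "m e z = Some z" and uniq: "\<And>e'. \<lbrakk>e' \<in> E; m e' z \<noteq> None\<rbrakk> \<Longrightarrow> e' = e"
    using ex1_left_unit[OF z] left_unit z by blast
  have "e \<in> X" using e units_subset by auto
  have "(\<one>\<^bsub>A\<^esub> \<otimes>\<^bsub>A\<^esub> f) z = (\<Oplus>p\<in>factorisations z. \<one>\<^bsub>A\<^esub> (fst p) \<otimes> f (snd p))"
    using f z by (simp add: A_mult_apply A_closed)
  also have "\<dots> = (\<Oplus>p\<in>{(e, z)}. \<one>\<^bsub>A\<^esub> (fst p) \<otimes> f (snd p))"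
  proof (rule finsum_subset[symmetric])
    fix p assume p: "p \<in> factorisations z - {(e, z)}"
    have "fst p \<notin> E"
    proof
      assume E: "fst p \<in> E"
      with p have "snd p = z"
        by (auto simp: factorisations_def dest: left_unit)
      with p E uniq show False
        by (cases p) (auto simp: factorisations_def)
    qed
    moreover have "fst p \<in> X" "snd p \<in> X"
      using p by auto
    ultimately show "\<one>\<^bsub>A\<^esub> (fst p) \<otimes> f (snd p) = \<zero>"
      using f by (simp add: A_one_apply)
  qed (use f z e \<open>e \<in> X\<close> in \<open>simp_all add: factorisations_def A_closed\<close>)
  also have "\<dots> = f z"
    using f z e \<open>e \<in> X\<close> by (simp add: A_one_apply)
  finally show "(\<one>\<^bsub>A\<^esub> \<otimes>\<^bsub>A\<^esub> f) z = f z" .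
qed (use f in \<open>simp_all add: A_mult_closed A_closed\<close>)

lemma A_r_one: assumes f: "f \<in> carrier A" shows "f \<otimes>\<^bsub>A\<^esub> \<one>\<^bsub>A\<^esub> = f"
proof (rule A_eqI)
  fix z assume z: "z \<in> X"
  obtain e where e: "e \<in> E" "m z e = Some z" and uniq: "\<And>e'. \<lbrakk>e' \<in> E; m z e' \<noteq> None\<rbrakk> \<Longrightarrow> e' = e"
    using ex1_right_unit[OF z] right_unit z by blast
  have "e \<in> X" using e units_subset by auto
  have "(f \<otimes>\<^bsub>A\<^esub> \<one>\<^bsub>A\<^esub>) z = (\<Oplus>p\<in>factorisations z. f (fst p) \<otimes> \<one>\<^bsub>A\<^esub> (snd p))"
    using f z by (simp add: A_mult_apply A_closed)
  also have "\<dots> = (\<Oplus>p\<in>{(z, e)}. f (fst p) \<otimes> \<one>\<^bsub>A\<^esub> (snd p))"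
  proof (rule finsum_subset[symmetric])
    fix p assume p: "p \<in> factorisations z - {(z, e)}"
    have "snd p \<notin> E"
    proof
      assume E: "snd p \<in> E"
      with p have "fst p = z"
        by (auto simp: factorisations_def dest: right_unit)
      with p E uniq show False
        by (cases p) (auto simp: factorisations_def)
    qed
    moreover have "fst p \<in> X" "snd p \<in> X"
      using p by auto
    ultimately show "f (fst p) \<otimes> \<one>\<^bsub>A\<^esub> (snd p) = \<zero>"
      using f by (simp add: A_one_apply)
  qed (use f z e \<open>e \<in> X\<close> in \<open>simp_all add: factorisations_def A_closed\<close>)
  also have "\<dots> = f z"
    using f z e \<open>e \<in> X\<close> by (simp add: A_one_apply)
  finally show "(f \<otimes>\<^bsub>A\<^esub> \<one>\<^bsub>A\<^esub>) z = f z" .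
qed (use f in \<open>simp_all add: A_mult_closed A_closed\<close>)

lemma A_abelian_group: "abelian_group A"
proof (rule abelian_groupI)
  fix f assume f: "f \<in> carrier A"
  have "(\<lambda>x\<in>X. \<ominus> f x) \<in> carrier A"
    using f by (simp add: carrier_A PiE_iff)
  moreover from this have "(\<lambda>x\<in>X. \<ominus> f x) \<oplus>\<^bsub>A\<^esub> f = \<zero>\<^bsub>A\<^esub>"
    by (rule A_eqI[OF A_closed(3)[OF _ f]]) (use f in \<open>simp_all add: A_apply A_closed l_neg\<close>)
  ultimately show "\<exists>g\<in>carrier A. g \<oplus>\<^bsub>A\<^esub> f = \<zero>\<^bsub>A\<^esub>" by blast
qed (auto intro!: A_eqI simp: A_apply A_closed a_ac)

lemma A_assoc_algebra: "assoc_algebra R A"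
proof -
  have mod: "module R A"
    by (rule moduleI)
      (auto intro!: A_eqI simp: A_apply A_closed A_abelian_group is_cring l_distr r_distr m_assoc)
  have ring: "ring A"
  proof (intro ringI A_abelian_group)
    show "monoid A"
      by (rule monoidI) (simp_all add: A_closed A_mult_closed A_mult_assoc A_l_one A_r_one)
    fix f g h assume *: "f \<in> carrier A" "g \<in> carrier A" "h \<in> carrier A"
    show "(f \<oplus>\<^bsub>A\<^esub> g) \<otimes>\<^bsub>A\<^esub> h = f \<otimes>\<^bsub>A\<^esub> h \<oplus>\<^bsub>A\<^esub> g \<otimes>\<^bsub>A\<^esub> h"
    proof (rule A_eqI)
      fix z assume "z \<in> X"
      then show "((f \<oplus>\<^bsub>A\<^esub> g) \<otimes>\<^bsub>A\<^esub> h) z = (f \<otimes>\<^bsub>A\<^esub> h \<oplus>\<^bsub>A\<^esub> g \<otimes>\<^bsub>A\<^esub> h) z"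
        using * by (simp add: A_apply A_closed l_distr Pi_iff flip: finsum_addf cong: finsum_cong)
    qed (use * in \<open>simp_all add: A_closed A_mult_closed\<close>)
    show "h \<otimes>\<^bsub>A\<^esub> (f \<oplus>\<^bsub>A\<^esub> g) = h \<otimes>\<^bsub>A\<^esub> f \<oplus>\<^bsub>A\<^esub> h \<otimes>\<^bsub>A\<^esub> g"
    proof (rule A_eqI)
      fix z assume "z \<in> X"
      then show "(h \<otimes>\<^bsub>A\<^esub> (f \<oplus>\<^bsub>A\<^esub> g)) z = (h \<otimes>\<^bsub>A\<^esub> f \<oplus>\<^bsub>A\<^esub> h \<otimes>\<^bsub>A\<^esub> g) z"
        using * by (simp add: A_apply A_closed r_distr Pi_iff flip: finsum_addf cong: finsum_cong)
    qed (use * in \<open>simp_all add: A_closed A_mult_closed\<close>)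
  qed
  show ?thesis
  proof (intro assoc_algebra.intro mod ring assoc_algebra_axioms.intro)
    fix a f g assume *: "a \<in> carrier R" "f \<in> carrier A" "g \<in> carrier A"
    show "(a \<odot>\<^bsub>A\<^esub> f) \<otimes>\<^bsub>A\<^esub> g = a \<odot>\<^bsub>A\<^esub> (f \<otimes>\<^bsub>A\<^esub> g)"
    proof (rule A_eqI)
      fix z assume "z \<in> X"
      then show "((a \<odot>\<^bsub>A\<^esub> f) \<otimes>\<^bsub>A\<^esub> g) z = (a \<odot>\<^bsub>A\<^esub> (f \<otimes>\<^bsub>A\<^esub> g)) z"
        using * by (simp add: A_apply A_closed A_mult_closed finsum_rdistr Pi_iff m_assoc cong: finsum_cong)
    qed (use * in \<open>simp_all add: A_closed A_mult_closed\<close>)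
    show "f \<otimes>\<^bsub>A\<^esub> (a \<odot>\<^bsub>A\<^esub> g) = a \<odot>\<^bsub>A\<^esub> (f \<otimes>\<^bsub>A\<^esub> g)"
    proof (rule A_eqI)
      fix z assume "z \<in> X"
      then show "(f \<otimes>\<^bsub>A\<^esub> (a \<odot>\<^bsub>A\<^esub> g)) z = (a \<odot>\<^bsub>A\<^esub> (f \<otimes>\<^bsub>A\<^esub> g)) z"
        using * by (simp add: A_apply A_closed A_mult_closed finsum_rdistr Pi_iff m_lcomm cong: finsum_cong)
    qed (use * in \<open>simp_all add: A_closed A_mult_closed\<close>)
  qed
qed

text \<open>For an infinite index set both sides take the default value zero of
  \<open>finsum\<close>, so the induction covers every \<open>I\<close>.\<close>

lemma A_finsum_apply:
  assumes "\<And>i. i \<in> I \<Longrightarrow> f i \<in> carrier A" "x \<in> X"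
  shows "(\<Oplus>\<^bsub>A\<^esub>i\<in>I. f i) x = (\<Oplus>i\<in>I. f i x)"
proof -
  interpret A: abelian_group A by (rule A_abelian_group)
  show ?thesis
    using assms
    by (induction I rule: infinite_finite_induct) (auto simp: A_apply Pi_iff A.finsum_infinite)
qed

end

text \<open>The indicator function of \<open>S\<close> on \<open>X\<close>. The unit and all
  elements \<open>ell R Q prec p\<close> have this form, which reduces products in the path algebra
  to computations with sets of paths.\<close>

definition set_vector :: "('k, 'r) ring_scheme \<Rightarrow> 'x set \<Rightarrow> 'x set \<Rightarrow> 'x \<Rightarrow> 'k"
  where "set_vector R X S = (\<lambda>x\<in>X. if x \<in> S then \<one>\<^bsub>R\<^esub> else \<zero>\<^bsub>R\<^esub>)"

context finite_multiplicative_basis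
begin

lemma set_vector_closed [simp]: "set_vector R X S \<in> carrier A"
  by (simp add: set_vector_def carrier_A)

lemma set_vector_apply: "x \<in> X \<Longrightarrow> set_vector R X S x = (if x \<in> S then \<one> else \<zero>)"
  by (simp add: set_vector_def)

lemma basis_vector_closed [simp]: "basis_vector R X x \<in> carrier A"
  by (simp add: basis_vector_def carrier_A)

lemma finsum_basis_vector:
  assumes "S \<subseteq> X"
  shows "(\<Oplus>\<^bsub>A\<^esub>x\<in>S. basis_vector R X x) = set_vector R X S"
proof -
  interpret A: abelian_group A by (rule A_abelian_group)
  show ?thesis
  proof (rule A_eqI)
    fix y assume y: "y \<in> X"
    have "(\<Oplus>\<^bsub>A\<^esub>x\<in>S. basis_vector R X x) y = (\<Oplus>x\<in>S. if y = x then \<one> else \<zero>)"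
      using y by (simp add: A_finsum_apply) (simp add: basis_vector_def)
    also have "\<dots> = set_vector R X S y"
    proof (cases "y \<in> S")
      case True
      then show ?thesis
        using y finsum_singleton[OF True finite_subset[OF assms finite_basis], of "\<lambda>_. \<one>"]
        by (simp add: set_vector_apply)
    next
      case False
      then have "(\<Oplus>x\<in>S. if y = x then \<one> else \<zero>) = (\<Oplus>x\<in>S. \<zero>)"
        by (intro finsum_cong') auto
      with False y show ?thesis by (simp add: set_vector_apply finsum_zero)
    qed
    finally show "(\<Oplus>\<^bsub>A\<^esub>x\<in>S. basis_vector R X x) y = set_vector R X S y" .
  qed auto
qed

lemma set_vector_Un:
  assumes "S \<inter> T = {}"
  shows "set_vector R X S \<oplus>\<^bsub>A\<^esub> set_vector R X T = set_vector R X (S \<union> T)"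
  by (rule A_eqI) (use assms in \<open>auto simp: A_closed A_apply set_vector_apply\<close>)

lemma one_eq_set_vector: "\<one>\<^bsub>A\<^esub> = set_vector R X E"
  by (rule A_eqI) (auto simp: A_closed A_apply set_vector_apply)

text \<open>The coefficient at \<open>z\<close> counts, inside the ring, the factorisations of
  \<open>z\<close> with factors in \<open>S\<close> and \<open>T\<close>. The hypothesis
  \<open>inj\<close> bounds this count by one, so no multiplicities arise.\<close>

lemma set_vector_mult:
  assumes ST: "S \<subseteq> X" "T \<subseteq> X"
    and inj: "\<And>x y x' y' z. \<lbrakk>x \<in> S; y \<in> T; x' \<in> S; y' \<in> T; m x y = Some z; m x' y' = Some z\<rbrakk>
      \<Longrightarrow> x = x' \<and> y = y'"
  shows "set_vector R X S \<otimes>\<^bsub>A\<^esub> set_vector R X T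
    = set_vector R X {z. \<exists>x\<in>S. \<exists>y\<in>T. m x y = Some z}" (is "_ = set_vector R X ?U")
proof (rule A_eqI)
  fix z assume z: "z \<in> X"
  let ?F = "factorisations z \<inter> S \<times> T"
  have "(set_vector R X S \<otimes>\<^bsub>A\<^esub> set_vector R X T) z
      = (\<Oplus>p\<in>factorisations z. set_vector R X S (fst p) \<otimes> set_vector R X T (snd p))"
    using z by (simp add: A_apply)
  also have "\<dots> = (\<Oplus>p\<in>factorisations z. if p \<in> S \<times> T then \<one> else \<zero>)"
    by (intro finsum_cong'[OF refl]) (auto simp: set_vector_apply mem_Times_iff)
  also have "\<dots> = (\<Oplus>p\<in>?F. \<one>)"
    by (rule add.finprod_mono_neutral_cong_right) auto
  also have "\<dots> = set_vector R X ?U z"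
  proof (cases "z \<in> ?U")
    case True
    then obtain x y where xy: "x \<in> S" "y \<in> T" "m x y = Some z" by blast
    then have "?F = {(x, y)}"
      using ST by (auto simp: factorisations_def dest: inj)
    with True z show ?thesis by (simp add: set_vector_apply)
  next
    case False
    then have "?F = {}" by (auto simp: factorisations_def)
    with False z show ?thesis by (simp add: set_vector_apply)
  qed
  finally show "(set_vector R X S \<otimes>\<^bsub>A\<^esub> set_vector R X T) z = set_vector R X ?U z" .
qed (auto intro: A_mult_closed)

section \<open>Linear extensions as algebra homomorphisms\<close>

lemma linear_extension_conv:
  assumes "assoc_algebra R B" "\<phi> \<in> X \<rightarrow> carrier B" "f \<in> carrier A"
  shows "linear_extension R X B \<phi> f = (\<Oplus>\<^bsub>B\<^esub>x\<in>X. f x \<odot>\<^bsub>B\<^esub> \<phi> x)"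
proof -
  interpret B: assoc_algebra R B by fact
  show ?thesis
    unfolding linear_extension_def
    by (rule B.finsum_subset) (use assms in \<open>auto simp: Pi_iff B.smult_l_null\<close>)
qed

text \<open>For products, expand the right-hand side over \<open>X \<times> X\<close> and group the
  pairs by their product. Pairs with product \<open>z\<close> give the coefficient of
  \<open>\<phi> z\<close>; pairs without a product contribute zero by \<open>mult\<close>.\<close>

lemma linear_extension_hom:
  assumes B: "assoc_algebra R B" and \<phi>: "\<phi> \<in> X \<rightarrow> carrier B"
    and mult: "\<And>x y. \<lbrakk>x \<in> X; y \<in> X\<rbrakk>
      \<Longrightarrow> \<phi> x \<otimes>\<^bsub>B\<^esub> \<phi> y = (case m x y of None \<Rightarrow> \<zero>\<^bsub>B\<^esub> | Some z \<Rightarrow> \<phi> z)"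
    and one: "(\<Oplus>\<^bsub>B\<^esub>x\<in>E. \<phi> x) = \<one>\<^bsub>B\<^esub>"
  shows "linear_extension R X B \<phi> \<in> ring_hom A B"
    and "\<lbrakk>a \<in> carrier R; f \<in> carrier A\<rbrakk>
      \<Longrightarrow> linear_extension R X B \<phi> (a \<odot>\<^bsub>A\<^esub> f) = a \<odot>\<^bsub>B\<^esub> linear_extension R X B \<phi> f"
proof -
  interpret B: assoc_algebra R B by (rule B)
  note conv = linear_extension_conv[OF B \<phi>]
  have \<phi>_closed [simp]: "x \<in> X \<Longrightarrow> \<phi> x \<in> carrier B" for x
    using \<phi> by auto
  show "linear_extension R X B \<phi> (a \<odot>\<^bsub>A\<^esub> f) = a \<odot>\<^bsub>B\<^esub> linear_extension R X B \<phi> f"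
    if "a \<in> carrier R" "f \<in> carrier A"
    using that
    by (simp add: conv A_closed A_apply B.finsum_smult_ldistr Pi_iff B.smult_assoc1 cong: B.finsum_cong)
  have closed: "linear_extension R X B \<phi> f \<in> carrier B" if "f \<in> carrier A" for f
    using that by (simp add: conv Pi_iff)
  show "linear_extension R X B \<phi> \<in> ring_hom A B"
  proof (rule ring_hom_memI)
    fix f assume "f \<in> carrier A"
    then show "linear_extension R X B \<phi> f \<in> carrier B"
      by (rule closed)
  next
    fix f g assume fg: "f \<in> carrier A" "g \<in> carrier A"
    show "linear_extension R X B \<phi> (f \<oplus>\<^bsub>A\<^esub> g) = linear_extension R X B \<phi> f \<oplus>\<^bsub>B\<^esub> linear_extension R X B \<phi> g"
      using fg
      by (simp add: conv A_closed A_apply B.smult_l_distr Pi_iff flip: B.finsum_addf cong: B.finsum_cong)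
    define t where "t p = (f (fst p) \<otimes> g (snd p)) \<odot>\<^bsub>B\<^esub> (\<phi> (fst p) \<otimes>\<^bsub>B\<^esub> \<phi> (snd p))" for p
    have t_closed: "t p \<in> carrier B" if "p \<in> X \<times> X" for p
      using that fg by (auto simp: t_def)
    have "linear_extension R X B \<phi> (f \<otimes>\<^bsub>A\<^esub> g)
        = (\<Oplus>\<^bsub>B\<^esub>z\<in>X. (\<Oplus>p\<in>factorisations z. f (fst p) \<otimes> g (snd p)) \<odot>\<^bsub>B\<^esub> \<phi> z)"
      using fg by (simp add: conv A_mult_closed A_mult_apply Pi_iff cong: B.finsum_cong)
    also have "\<dots> = (\<Oplus>\<^bsub>B\<^esub>z\<in>X. \<Oplus>\<^bsub>B\<^esub>p\<in>factorisations z. t p)"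
    proof (rule B.finsum_cong'[OF refl])
      fix z assume z: "z \<in> X"
      \<comment> \<open>The claim is made for every subset \<open>F\<close> of the factorisations of
        \<open>z\<close>, which gives room for an induction on \<open>F\<close>.\<close>
      have "(\<Oplus>p\<in>F. f (fst p) \<otimes> g (snd p)) \<odot>\<^bsub>B\<^esub> \<phi> z = (\<Oplus>\<^bsub>B\<^esub>p\<in>F. t p)"
        if "F \<subseteq> factorisations z" for F
        using finite_subset[OF that finite_factorisations] that
      proof (induction F rule: finite_induct)
        case empty
        with z show ?case by (simp add: B.smult_l_null)
      next
        case (insert p F)
        then have p: "p \<in> factorisations z" "fst p \<in> X" "snd p \<in> X" and F: "F \<subseteq> factorisations z"
          by auto
        then have "m (fst p) (snd p) = Some z"
          by (simp add: factorisations_def)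
        then have "t p = (f (fst p) \<otimes> g (snd p)) \<odot>\<^bsub>B\<^esub> \<phi> z"
          using p by (simp add: t_def mult)
        moreover have "\<forall>q\<in>F. fst q \<in> X \<and> snd q \<in> X"
          using F fst_factorisations snd_factorisations by blast
        ultimately show ?case
          using insert p z fg t_closed
          by (simp add: Pi_iff B.smult_l_distr mem_Times_iff)
      qed
      then show "(\<Oplus>p\<in>factorisations z. f (fst p) \<otimes> g (snd p)) \<odot>\<^bsub>B\<^esub> \<phi> z
          = (\<Oplus>\<^bsub>B\<^esub>p\<in>factorisations z. t p)" by blast
    qed (auto simp: Pi_iff factorisations_def intro!: B.finsum_closed t_closed)
    also have "\<dots> = (\<Oplus>\<^bsub>B\<^esub>p\<in>(\<Union>z\<in>X. factorisations z). t p)"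
      by (rule B.add.finprod_UN_disjoint[symmetric])
        (auto simp: pairwise_def disjnt_def factorisations_def intro: t_closed)
    also have "\<dots> = (\<Oplus>\<^bsub>B\<^esub>p\<in>X \<times> X. t p)"
    proof (rule B.finsum_subset)
      fix p assume p: "p \<in> X \<times> X - (\<Union>z\<in>X. factorisations z)"
      then have "m (fst p) (snd p) = None"
        by (cases "m (fst p) (snd p)") (auto simp: factorisations_def intro: mult_closed)
      with p fg show "t p = \<zero>\<^bsub>B\<^esub>"
        by (auto simp: t_def mult B.smult_r_null)
    qed (auto simp: factorisations_def intro: t_closed)
    also have "\<dots> = (\<Oplus>\<^bsub>B\<^esub>p\<in>X \<times> X. (f (fst p) \<odot>\<^bsub>B\<^esub> \<phi> (fst p)) \<otimes>\<^bsub>B\<^esub> (g (snd p) \<odot>\<^bsub>B\<^esub> \<phi> (snd p)))"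
      by (rule B.finsum_cong')
        (use fg in \<open>auto simp: t_def B.smult_mult_left B.smult_mult_right m_comm simp flip: B.smult_assoc1\<close>)
    also have "\<dots> = (\<Oplus>\<^bsub>B\<^esub>x\<in>X. \<Oplus>\<^bsub>B\<^esub>y\<in>X. (f x \<odot>\<^bsub>B\<^esub> \<phi> x) \<otimes>\<^bsub>B\<^esub> (g y \<odot>\<^bsub>B\<^esub> \<phi> y))"
      using fg B.finsum_Sigma[of X "\<lambda>_. X" "\<lambda>x y. (f x \<odot>\<^bsub>B\<^esub> \<phi> x) \<otimes>\<^bsub>B\<^esub> (g y \<odot>\<^bsub>B\<^esub> \<phi> y)"]
      by simp
    also have "\<dots> = (\<Oplus>\<^bsub>B\<^esub>x\<in>X. (f x \<odot>\<^bsub>B\<^esub> \<phi> x) \<otimes>\<^bsub>B\<^esub> linear_extension R X B \<phi> g)"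
      using fg by (simp add: conv B.finsum_rdistr Pi_iff cong: B.finsum_cong)
    also have "\<dots> = linear_extension R X B \<phi> f \<otimes>\<^bsub>B\<^esub> linear_extension R X B \<phi> g"
      using fg by (subst (2) conv) (simp_all add: closed B.finsum_ldistr Pi_iff)
    finally show "linear_extension R X B \<phi> (f \<otimes>\<^bsub>A\<^esub> g)
      = linear_extension R X B \<phi> f \<otimes>\<^bsub>B\<^esub> linear_extension R X B \<phi> g" .
  next
    have "linear_extension R X B \<phi> \<one>\<^bsub>A\<^esub> = (\<Oplus>\<^bsub>B\<^esub>x\<in>X. \<one>\<^bsub>A\<^esub> x \<odot>\<^bsub>B\<^esub> \<phi> x)"
      by (simp add: conv A_closed)
    also have "\<dots> = (\<Oplus>\<^bsub>B\<^esub>x\<in>E. \<phi> x)"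
      by (rule B.add.finprod_mono_neutral_cong_right)
        (use units_subset in \<open>auto simp: A_apply B.smult_l_null\<close>)
    finally show "linear_extension R X B \<phi> \<one>\<^bsub>A\<^esub> = \<one>\<^bsub>B\<^esub>"
      by (simp add: one)
  qed
qed

end

section \<open>Unitriangular systems\<close>

text \<open>The equation at \<open>x\<close> determines \<open>c x\<close> from the values of
  \<open>c\<close> below \<open>x\<close>, so well-founded recursion yields a solution and
  well-founded induction its uniqueness. As the diagonal entries are \<open>1\<close>, only
  subtraction is needed and the argument works over every commutative ring.\<close>

lemma (in cring) ex1_unitriangular_solution:
  assumes X: "finite X" and wf: "wf r" and f: "f \<in> X \<rightarrow> carrier R"
  shows "\<exists>!c. c \<in> X \<rightarrow>\<^sub>E carrier R \<and> (\<forall>x\<in>X. (\<Oplus>p\<in>{p \<in> X. p = x \<or> (p, x) \<in> r}. c p) = f x)"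
proof -
  define below where "below x = {p \<in> X. (p, x) \<in> r}" for x
  have row: "(\<Oplus>p\<in>{p \<in> X. p = x \<or> (p, x) \<in> r}. c p) = c x \<oplus> (\<Oplus>p\<in>below x. c p)"
    if "c \<in> X \<rightarrow>\<^sub>E carrier R" "x \<in> X" for c x
  proof -
    have "{p \<in> X. p = x \<or> (p, x) \<in> r} = insert x (below x)"
      using that by (auto simp: below_def)
    moreover have "x \<notin> below x" "finite (below x)" "c \<in> below x \<rightarrow> carrier R" "c x \<in> carrier R"
      using wf X that by (auto simp: below_def)
    ultimately show ?thesis by simp
  qed
  define c where "c = wfrec r (\<lambda>c x. f x \<ominus> (\<Oplus>p\<in>below x. c p))"
  \<comment> \<open>The recursor passes on \<open>c\<close> cut off to the predecessors of
    \<open>x\<close>; the sum only reads such values.\<close>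
  have cut_eq: "finsum R (cut c r x) (below x) = finsum R c (below x)"
    if "c \<in> below x \<rightarrow> carrier R" for c x
    by (rule finsum_cong'[OF refl that]) (simp add: cut_apply below_def)
  have c_closed: "c x \<in> carrier R" if "x \<in> X" for x
    using wf that
  proof (induction x rule: wf_induct_rule)
    case (less x)
    then have *: "c \<in> below x \<rightarrow> carrier R" by (auto simp: below_def)
    have "c x = f x \<ominus> (\<Oplus>p\<in>below x. c p)"
      by (subst c_def, subst wfrec[OF wf]) (simp add: cut_eq[OF *] flip: c_def)
    with * f less.prems show ?case by auto
  qed
  have c_eq: "c x = f x \<ominus> (\<Oplus>p\<in>below x. c p)" if "x \<in> X" for x
  proof -
    have *: "c \<in> below x \<rightarrow> carrier R" by (auto simp: below_def c_closed)
    show ?thesis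
      by (subst c_def, subst wfrec[OF wf]) (simp add: cut_eq[OF *] flip: c_def)
  qed
  \<comment> \<open>The recursion defines \<open>c\<close> on the whole type; restricting it to
    \<open>X\<close> makes it extensional, as uniqueness requires.\<close>
  show ?thesis
  proof (rule ex1I[of _ "restrict c X"])
    have "(\<Oplus>p\<in>below x. restrict c X p) = (\<Oplus>p\<in>below x. c p)" for x
      by (rule finsum_cong') (auto simp: below_def c_closed)
    moreover have "f x \<ominus> s \<oplus> s = f x" if "x \<in> X" "s \<in> carrier R" for x s
      using that funcset_mem[OF f] by (simp add: minus_eq a_assoc l_neg)
    moreover have "(\<Oplus>p\<in>below x. c p) \<in> carrier R" for x
      by (rule finsum_closed) (auto simp: below_def c_closed)
    moreover have "restrict c X \<in> X \<rightarrow>\<^sub>E carrier R"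
      using c_closed by simp
    ultimately show "restrict c X \<in> X \<rightarrow>\<^sub>E carrier R \<and>
        (\<forall>x\<in>X. (\<Oplus>p\<in>{p \<in> X. p = x \<or> (p, x) \<in> r}. restrict c X p) = f x)"
      using row[of "restrict c X"] by (simp add: c_eq del: restrict_apply) (simp add: c_eq)
  next
    fix d assume d: "d \<in> X \<rightarrow>\<^sub>E carrier R \<and> (\<forall>x\<in>X. (\<Oplus>p\<in>{p \<in> X. p = x \<or> (p, x) \<in> r}. d p) = f x)"
    have "d x = c x" if "x \<in> X" for x
      using wf that
    proof (induction x rule: wf_induct_rule)
      case (less x)
      have *: "(\<Oplus>p\<in>below x. d p) = (\<Oplus>p\<in>below x. c p)"
        using less.IH by (intro finsum_cong') (auto simp: below_def c_closed)
      have s: "(\<Oplus>p\<in>below x. c p) \<in> carrier R"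
        by (rule finsum_closed) (auto simp: below_def c_closed)
      have "d x \<oplus> (\<Oplus>p\<in>below x. c p) = f x"
        using d less.prems row[of d x] * by simp
      moreover have "d x \<in> carrier R"
        using d less.prems by auto
      ultimately have "f x \<ominus> (\<Oplus>p\<in>below x. c p) = d x"
        using s by (metis a_assoc a_inv_closed minus_eq r_neg r_zero)
      then show ?case using c_eq less.prems by simp
    qed
    with d show "d = restrict c X"
      by (intro PiE_ext[of _ X "\<lambda>_. carrier R"]) (auto simp: c_closed)
  qed
qed

section \<open>Unitriangular families of vectors as bases\<close>

context finite_multiplicative_basis
begin

text \<open>The combination of the vectors \<open>b p\<close> with coefficients
  \<open>f (b p)\<close> has at \<open>x\<close> the sum of those coefficients for which
  \<open>x \<in> L p\<close>. By \<open>refl_L\<close> and \<open>wf_L\<close> this is a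
  unitriangular system: existence of solutions gives surjectivity, uniqueness gives
  injectivity.\<close>

lemma bij_betw_linear_extension_unitriangular:
  fixes L :: "'x \<Rightarrow> 'x set"
  defines "b \<equiv> \<lambda>p. set_vector R X (L p)"
  assumes nontrivial: "\<one> \<noteq> \<zero>"
    and refl_L: "\<And>p. p \<in> X \<Longrightarrow> p \<in> L p"
    and wf_L: "wf {(p, x). p \<in> X \<and> x \<in> L p \<and> x \<noteq> p}"
  shows "bij_betw (linear_extension R (b ` X) A (\<lambda>v. v)) (b ` X \<rightarrow>\<^sub>E carrier R) (carrier A)"
proof -
  let ?r = "{(p, x). p \<in> X \<and> x \<in> L p \<and> x \<noteq> p}"
  interpret A: assoc_algebra R A by (rule A_assoc_algebra)
  have b_closed: "b p \<in> carrier A" for p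
    by (simp add: b_def)
  \<comment> \<open>Coefficients are indexed by the vectors \<open>b p\<close>, while the system is
    indexed by \<open>p\<close>. If two vectors agree then, since \<open>1\<close> differs from
    \<open>0\<close>, each of \<open>p\<close> and \<open>q\<close> lies in the set of the other,
    and a well-founded relation excludes this for distinct elements.\<close>
  have inj: "inj_on b X"
  proof (rule inj_onI)
    fix p q assume pq: "p \<in> X" "q \<in> X" and eq: "b p = b q"
    have "x \<in> L p \<longleftrightarrow> x \<in> L q" if "x \<in> X" for x
      using fun_cong[OF eq, of x] that nontrivial by (auto simp: b_def set_vector_apply split: if_splits)
    then have "p \<in> L q" "q \<in> L p" using pq refl_L by auto
    then show "p = q" using wf_not_sym[OF wf_L, of p q] pq by auto
  qed
  have lin: "linear_extension R (b ` X) A (\<lambda>v. v) f x = (\<Oplus>p\<in>{p \<in> X. p = x \<or> (p, x) \<in> ?r}. f (b p))"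
    if f: "f \<in> b ` X \<rightarrow>\<^sub>E carrier R" and x: "x \<in> X" for f x
  proof -
    have "linear_extension R (b ` X) A (\<lambda>v. v) f = (\<Oplus>\<^bsub>A\<^esub>v\<in>b ` X. f v \<odot>\<^bsub>A\<^esub> v)"
      unfolding linear_extension_def
      by (rule A.finsum_subset) (use f b_closed in \<open>auto simp: A.smult_l_null\<close>)
    also have "\<dots> = (\<Oplus>\<^bsub>A\<^esub>p\<in>X. f (b p) \<odot>\<^bsub>A\<^esub> b p)"
      by (rule A.finsum_reindex[OF _ inj]) (use f b_closed in auto)
    finally have lin: "linear_extension R (b ` X) A (\<lambda>v. v) f x = (\<Oplus>p\<in>X. (f (b p) \<odot>\<^bsub>A\<^esub> b p) x)"
      using f x b_closed by (simp add: A_finsum_apply PiE_iff)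
    have f_closed: "f (set_vector R X (L p)) \<in> carrier R" if "p \<in> X" for p
      using f that by (auto simp: b_def)
    have "(\<Oplus>p\<in>X. (f (b p) \<odot>\<^bsub>A\<^esub> b p) x) = (\<Oplus>p\<in>{p \<in> X. p = x \<or> (p, x) \<in> ?r}. f (b p))"
      by (rule add.finprod_mono_neutral_cong_right)
        (use f_closed x refl_L in \<open>auto simp: A_apply b_def set_vector_apply\<close>)
    with lin show ?thesis by simp
  qed
  have closed: "linear_extension R (b ` X) A (\<lambda>v. v) f \<in> carrier A" if "f \<in> b ` X \<rightarrow>\<^sub>E carrier R" for f
    unfolding linear_extension_def by (rule A.finsum_closed) (use that b_closed in auto)
  show "bij_betw (linear_extension R (b ` X) A (\<lambda>v. v)) (b ` X \<rightarrow>\<^sub>E carrier R) (carrier A)"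
  proof (rule bij_betw_imageI)
    show "inj_on (linear_extension R (b ` X) A (\<lambda>v. v)) (b ` X \<rightarrow>\<^sub>E carrier R)"
    proof (rule inj_onI)
      fix f g assume f: "f \<in> b ` X \<rightarrow>\<^sub>E carrier R" and g: "g \<in> b ` X \<rightarrow>\<^sub>E carrier R"
        and eq: "linear_extension R (b ` X) A (\<lambda>v. v) f = linear_extension R (b ` X) A (\<lambda>v. v) g"
      define c where "c f = (\<lambda>p\<in>X. f (b p))" for f :: "('x \<Rightarrow> 'a) \<Rightarrow> 'a"
      have c: "c f \<in> X \<rightarrow>\<^sub>E carrier R \<and> (\<forall>x\<in>X. (\<Oplus>p\<in>{p \<in> X. p = x \<or> (p, x) \<in> ?r}. c f p)
          = linear_extension R (b ` X) A (\<lambda>v. v) f x)" if f: "f \<in> b ` X \<rightarrow>\<^sub>E carrier R" for f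
      proof -
        have "(\<Oplus>p\<in>{p \<in> X. p = x \<or> (p, x) \<in> ?r}. c f p) = (\<Oplus>p\<in>{p \<in> X. p = x \<or> (p, x) \<in> ?r}. f (b p))" for x
          by (rule finsum_cong') (use f in \<open>auto simp: c_def\<close>)
        then show ?thesis using f by (auto simp: lin c_def)
      qed
      have "linear_extension R (b ` X) A (\<lambda>v. v) g \<in> X \<rightarrow> carrier R"
        using closed[OF g] by auto
      from ex1_unitriangular_solution[OF finite_basis wf_L this] have "c f = c g"
        using c[OF f] c[OF g] unfolding eq by blast
      then have "f (b p) = g (b p)" if "p \<in> X" for p
        using that unfolding c_def by (metis restrict_apply')
      then show "f = g" by (intro PiE_ext[OF f g]) auto
    qed
    have "\<exists>f\<in>b ` X \<rightarrow>\<^sub>E carrier R. linear_extension R (b ` X) A (\<lambda>v. v) f = g" if g: "g \<in> carrier A" for g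
    proof -
      have "g \<in> X \<rightarrow> carrier R" using g by auto
      from ex1_implies_ex[OF ex1_unitriangular_solution[OF finite_basis wf_L this]]
      obtain c where c: "c \<in> X \<rightarrow>\<^sub>E carrier R"
        and sol: "\<And>x. x \<in> X \<Longrightarrow> (\<Oplus>p\<in>{p \<in> X. p = x \<or> (p, x) \<in> ?r}. c p) = g x"
        by blast
      define f where "f = (\<lambda>v\<in>b ` X. c (inv_into X b v))"
      have f: "f \<in> b ` X \<rightarrow>\<^sub>E carrier R"
        using c inj by (auto simp: f_def)
      have "linear_extension R (b ` X) A (\<lambda>v. v) f x = g x" if x: "x \<in> X" for x
      proof -
        have "linear_extension R (b ` X) A (\<lambda>v. v) f x = (\<Oplus>p\<in>{p \<in> X. p = x \<or> (p, x) \<in> ?r}. c p)"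
          unfolding lin[OF f x] by (rule finsum_cong') (use c inj in \<open>auto simp: f_def\<close>)
        with sol x show ?thesis by simp
      qed
      then have "linear_extension R (b ` X) A (\<lambda>v. v) f = g"
        by (rule A_eqI[OF closed[OF f] g])
      with f show ?thesis by blast
    qed
    with closed show "linear_extension R (b ` X) A (\<lambda>v. v) ` (b ` X \<rightarrow>\<^sub>E carrier R) = carrier A"
      by blast
  qed
qed

end

section \<open>Paths of an ordered quiver\<close>

text \<open>The nonempty suffixes of a walk, each with its own source, which index the second sum of
  \<open>ell\<close>. The recursive form suits induction along walks;
  \<open>arrow_suffixes_conv\<close> links it to the indexed form.\<close>

primrec arrow_suffixes :: "('v, 'e) pre_digraph \<Rightarrow> 'e list \<Rightarrow> ('v, 'e) path set"
  where
    "arrow_suffixes Q [] = {}"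
  | "arrow_suffixes Q (a # as) = insert (tail Q a, a # as) (arrow_suffixes Q as)"

lemma arrow_suffixes_conv:
  "arrow_suffixes Q as = (\<lambda>i. (tail Q (as ! i), drop i as)) ` {..<length as}"
  by (induction as) (simp_all add: lessThan_Suc_eq_insert_0 image_image del: lessThan_Suc)

text \<open>A suffix of the concatenation either starts inside \<open>bs\<close>, or starts inside
  \<open>as\<close> and contains all of \<open>bs\<close>.\<close>

lemma arrow_suffixes_append:
  "arrow_suffixes Q (as @ bs)
    = arrow_suffixes Q bs \<union> (\<lambda>x. (fst x, snd x @ bs)) ` arrow_suffixes Q as"
  by (induction as) auto

lemma arrow_suffixes_nonempty: "x \<in> arrow_suffixes Q as \<Longrightarrow> snd x \<noteq> []"
  by (induction as) auto

lemma arrow_suffixes_shorter: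
  "x \<in> arrow_suffixes Q as \<Longrightarrow> x = (tail Q (hd as), as) \<or> length (snd x) < length as"
  by (induction as) auto

lemma path_concat_assoc:
  "Option.bind (path_concat Q p q) (\<lambda>w. path_concat Q w r)
    = Option.bind (path_concat Q q r) (path_concat Q p)"
  by (auto simp: path_concat_def path_target_def)

locale ordered_quiver = fin_digraph Q for Q :: "('v, 'e) pre_digraph" +
  fixes prec :: "'v rel"
  assumes linear: "strict_linear_order_on (verts Q) prec"
    and arc_prec: "e \<in> arcs Q \<Longrightarrow> (tail Q e, head Q e) \<in> prec"
begin

section \<open>The vertex order along walks\<close>

abbreviation less (infix \<open>\<prec>\<close> 50) where "u \<prec> v \<equiv> (u, v) \<in> prec"

definition less_eq (infix \<open>\<preceq>\<close> 50) where "u \<preceq> v \<longleftrightarrow> u = v \<or> u \<prec> v"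

lemma less_irrefl: "\<not> u \<prec> u"
  and less_trans: "\<lbrakk>u \<prec> v; v \<prec> w\<rbrakk> \<Longrightarrow> u \<prec> w"
  and less_total: "\<lbrakk>u \<in> verts Q; v \<in> verts Q\<rbrakk> \<Longrightarrow> u \<prec> v \<or> v \<preceq> u"
  using linear
  by (auto simp: strict_linear_order_on_def less_eq_def irrefl_def total_on_def dest: transD)

lemma less_eq_refl [simp]: "u \<preceq> u"
  and less_eq_trans: "\<lbrakk>u \<preceq> v; v \<preceq> w\<rbrakk> \<Longrightarrow> u \<preceq> w"
  and less_imp_less_eq: "u \<prec> v \<Longrightarrow> u \<preceq> v"
  and less_less_eq_trans: "\<lbrakk>u \<prec> v; v \<preceq> w\<rbrakk> \<Longrightarrow> u \<prec> w"
  and less_eq_not_less: "u \<preceq> v \<Longrightarrow> \<not> v \<prec> u"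
  unfolding less_eq_def using less_irrefl less_trans by blast+

lemma path_target_awalk: "awalk u as v \<Longrightarrow> path_target Q (u, as) = v"
  by (auto simp: path_target_def awalk_verts_conv elim: awalkE')

lemma quiver_pathsE:
  assumes "p \<in> quiver_paths Q"
  obtains u as v where "p = (u, as)" "awalk u as v" "path_target Q p = v"
  using assms path_target_awalk unfolding quiver_paths_def by blast

lemma quiver_pathsI: "awalk u as v \<Longrightarrow> (u, as) \<in> quiver_paths Q"
  unfolding quiver_paths_def by blast

lemma awalk_less_eq: "awalk u as v \<Longrightarrow> u \<preceq> v"
proof (induction as arbitrary: u)
  case (Cons a as)
  then have "tail Q a \<prec> head Q a" "head Q a \<preceq> v" "u = tail Q a"
    by (auto simp: awalk_Cons_iff arc_prec)
  then show ?case using less_eq_trans less_imp_less_eq by blast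
qed (auto simp: awalk_Nil_iff)

text \<open>Every arrow leads to a strictly larger vertex, so the heads of the arrows are distinct
  and all lie strictly above \<open>u\<close>. This bounds the length of all paths and makes their
  number finite.\<close>

lemma length_awalk_le: "awalk u as v \<Longrightarrow> length as \<le> card {w \<in> verts Q. u \<prec> w}"
proof (induction as arbitrary: u)
  case (Cons a as)
  then have a: "u = tail Q a" "u \<prec> head Q a" "head Q a \<in> verts Q" "awalk (head Q a) as v"
    by (auto simp: awalk_Cons_iff arc_prec)
  then have "insert (head Q a) {w \<in> verts Q. head Q a \<prec> w} \<subseteq> {w \<in> verts Q. u \<prec> w}"
    using less_trans by blast
  from card_mono[OF _ this] have "Suc (card {w \<in> verts Q. head Q a \<prec> w}) \<le> card {w \<in> verts Q. u \<prec> w}"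
    using less_irrefl by simp
  with Cons.IH[OF a(4)] show ?case by simp
qed simp

lemma length_awalk_le_card_verts: "awalk u as v \<Longrightarrow> length as \<le> card (verts Q)"
  by (rule order_trans[OF length_awalk_le]) (auto intro: card_mono)

lemma finite_quiver_paths: "finite (quiver_paths Q)"
proof (rule finite_subset)
  show "quiver_paths Q \<subseteq> verts Q \<times> {as. set as \<subseteq> arcs Q \<and> length as \<le> card (verts Q)}"
    by (auto simp: quiver_paths_def length_awalk_le_card_verts elim: awalkE')
  show "finite (verts Q \<times> {as. set as \<subseteq> arcs Q \<and> length as \<le> card (verts Q)})"
    by (simp add: finite_lists_length_le)
qed

text \<open>The bound \<open>s \<prec> v\<close> is strict because a suffix has at least one arrow.
  This strictness separates the suffixes from the stationary paths in \<open>support\<close>, which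
  sit weakly above \<open>v\<close>.\<close>

lemma arrow_suffixes_awalk:
  "\<lbrakk>awalk u as v; (s, bs) \<in> arrow_suffixes Q as\<rbrakk> \<Longrightarrow> awalk s bs v \<and> u \<preceq> s \<and> s \<prec> v"
proof (induction as arbitrary: u)
  case (Cons a as)
  then have a: "u = tail Q a" "u \<prec> head Q a" "awalk (head Q a) as v"
    by (auto simp: awalk_Cons_iff arc_prec)
  then have "u \<prec> v"
    using awalk_less_eq less_less_eq_trans by blast
  with Cons a show ?case
    using less_eq_trans[OF less_imp_less_eq] by auto
qed simp

text \<open>Vertices increase strictly along a walk, so no vertex is the source of two different
  suffixes.\<close>

lemma arrow_suffixes_source_inj:
  "\<lbrakk>awalk u as v; (s, bs) \<in> arrow_suffixes Q as; (s, cs) \<in> arrow_suffixes Q as\<rbrakk> \<Longrightarrow> bs = cs"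
proof (induction as arbitrary: u)
  case (Cons a as)
  then have a: "tail Q a \<prec> head Q a" "awalk (head Q a) as v"
    by (auto simp: awalk_Cons_iff arc_prec)
  then have "(tail Q a, ds) \<notin> arrow_suffixes Q as" for ds
    using arrow_suffixes_awalk less_eq_not_less by blast
  with Cons a show ?case by auto
qed simp

section \<open>Supports and their truncation\<close>

text \<open>The set of paths occurring in \<open>\<ell>(p)\<close> for a path \<open>p\<close> with target \<open>v\<close> and arrows \<open>as\<close>.\<close>

definition support :: "'v \<Rightarrow> 'e list \<Rightarrow> ('v, 'e) path set"
  where "support v as = (\<lambda>w. (w, [])) ` {w \<in> verts Q. v \<preceq> w} \<union> arrow_suffixes Q as"

lemma in_support_iff:
  "(s, bs) \<in> support v as \<longleftrightarrow> bs = [] \<and> s \<in> verts Q \<and> v \<preceq> s \<or> (s, bs) \<in> arrow_suffixes Q as"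
  by (auto simp: support_def)

lemma self_in_support: "awalk u as v \<Longrightarrow> (u, as) \<in> support v as"
  by (cases as) (auto simp: in_support_iff awalk_simps)

lemma support_awalk:
  assumes "awalk u as v" "(s, bs) \<in> support v as"
  shows "\<exists>w. awalk s bs w \<and> u \<preceq> s \<and> s \<in> verts Q"
  using assms(2) arrow_suffixes_awalk[OF assms(1)] awalk_less_eq[OF assms(1)] less_eq_trans
  by (fastforce simp: in_support_iff awalk_Nil_iff)

lemma support_subset:
  assumes "awalk u as v"
  shows "support v as \<subseteq> quiver_paths Q"
proof (rule subrelI)
  fix s bs assume "(s, bs) \<in> support v as"
  then obtain w where "awalk s bs w"
    using support_awalk[OF assms] by blast
  then show "(s, bs) \<in> quiver_paths Q" by (rule quiver_pathsI)
qed

lemma support_target: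
  assumes "awalk u as v" "x \<in> support v as"
  shows "v \<preceq> path_target Q x"
proof (cases "x \<in> arrow_suffixes Q as")
  case True
  then show ?thesis
    using arrow_suffixes_awalk[OF assms(1)] path_target_awalk by (cases x) fastforce
next
  case False
  with assms(2) show ?thesis
    by (auto simp: support_def path_target_def)
qed

text \<open>Stationary members have sources weakly above \<open>v\<close>, nonempty ones strictly
  below \<open>v\<close>, and among the latter the sources are distinct. This is what keeps
  multiplicities out of the products.\<close>

lemma support_source_inj:
  assumes "awalk u as v" "(s, bs) \<in> support v as" "(s, cs) \<in> support v as"
  shows "bs = cs"
  using assms(2,3) arrow_suffixes_awalk[OF assms(1)] arrow_suffixes_source_inj[OF assms(1)]
    less_eq_not_less
  unfolding in_support_iff by blast

text \<open>Arrows are dropped from the front of the walk until it starts weakly above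
  \<open>w\<close>. If no arrow survives, the stationary path at \<open>v\<close> is left, which
  qualifies because \<open>w \<preceq> v\<close>. The target stays \<open>v\<close>
  throughout.\<close>

lemma support_truncate:
  assumes "awalk u as v" "w \<preceq> v" "w \<in> verts Q"
  shows "\<exists>s bs. awalk s bs v \<and> w \<preceq> s \<and> support v bs = {y \<in> support v as. w \<preceq> fst y}"
  using assms(1)
proof (induction as arbitrary: u)
  case Nil
  then have "support v [] = {y \<in> support v []. w \<preceq> fst y}"
    using assms(2) less_eq_trans by (auto simp: in_support_iff)
  with Nil assms(2) show ?case
    by (metis awalk_Nil_iff)
next
  case (Cons a as)
  then have a: "u = tail Q a" "awalk (head Q a) as v" "u \<in> verts Q"
    by (auto simp: awalk_Cons_iff)
  show ?case
  proof (cases "w \<preceq> u")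
    case True
    then have "support v (a # as) = {y \<in> support v (a # as). w \<preceq> fst y}"
      using support_awalk[OF Cons.prems] less_eq_trans by fastforce
    with True Cons.prems show ?thesis by blast
  next
    case False
    have "support v (a # as) = insert (u, a # as) (support v as)"
      using a by (auto simp: support_def)
    with False have "{y \<in> support v (a # as). w \<preceq> fst y} = {y \<in> support v as. w \<preceq> fst y}"
      by auto
    with Cons.IH[OF a(2)] show ?thesis by simp
  qed
qed

section \<open>Products of supports\<close>

definition concat_set :: "('v, 'e) path set \<Rightarrow> ('v, 'e) path set \<Rightarrow> ('v, 'e) path set"
  where "concat_set S T = {z. \<exists>x\<in>S. \<exists>y\<in>T. path_concat Q x y = Some z}"

text \<open>Each \<open>x\<close> in the first support ends weakly above \<open>v\<close>, hence
  weakly above \<open>v'\<close>. Nonempty members of the second support start strictly below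
  \<open>v'\<close>, so the only partner of \<open>x\<close> is the stationary path at its target,
  and that one is present.\<close>

lemma concat_set_support_absorb:
  assumes p: "awalk u as v" and q: "awalk u' bs v'" and le: "v' \<preceq> v"
  shows "concat_set (support v as) (support v' bs) = support v as"
proof -
  have concat_iff: "path_concat Q x y = Some z \<longleftrightarrow> z = x \<and> y = (path_target Q x, [])"
    if x: "x \<in> support v as" and y: "y \<in> support v' bs" for x y z
  proof -
    obtain s cs where s: "x = (s, cs)" by (cases x)
    obtain t ds where t: "y = (t, ds)" by (cases y)
    have "v \<preceq> path_target Q x"
      using p x by (rule support_target)
    then have "t \<noteq> path_target Q x" if "(t, ds) \<in> arrow_suffixes Q bs"
      using arrow_suffixes_awalk[OF q that] le less_eq_trans less_eq_not_less by blast
    then have "ds = []" if "t = path_target Q x"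
      using that y t in_support_iff by blast
    then show ?thesis
      by (auto simp: path_concat_def s t)
  qed
  have "(path_target Q x, []) \<in> support v' bs" if x: "x \<in> support v as" for x
  proof -
    obtain s cs where s: "x = (s, cs)" by (cases x)
    obtain w where w: "awalk s cs w" using support_awalk[OF p] x s by blast
    have "v \<preceq> path_target Q x"
      using p x by (rule support_target)
    then show ?thesis
      using le less_eq_trans path_target_awalk[OF w] w s by (auto simp: in_support_iff)
  qed
  note unit = this
  show ?thesis
  proof (intro equalityI subsetI)
    fix z assume "z \<in> concat_set (support v as) (support v' bs)"
    then obtain x y where "x \<in> support v as" "y \<in> support v' bs" "path_concat Q x y = Some z"
      unfolding concat_set_def by blast
    with concat_iff show "z \<in> support v as" by simp
  next
    fix z assume z: "z \<in> support v as"
    with unit concat_iff have "path_concat Q z (path_target Q z, []) = Some z" by simp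
    with z unit show "z \<in> concat_set (support v as) (support v' bs)"
      unfolding concat_set_def by blast
  qed
qed

text \<open>Let \<open>cs\<close>, starting at \<open>s\<close>, be the truncation of the second
  walk at \<open>v\<close>. Stationary left factors pick out exactly the support of
  \<open>cs\<close>. Nonempty left factors end at \<open>v\<close> and need a partner starting
  there; there is one exactly if \<open>s = v\<close>. The result is the support of
  \<open>as @ cs\<close> if \<open>s = v\<close>, and that of \<open>cs\<close> otherwise.\<close>

lemma concat_set_support_less:
  assumes p: "awalk u as v" and q: "awalk u' bs v'" and less: "v \<prec> v'"
  shows "\<exists>s cs. awalk s cs v' \<and> concat_set (support v as) (support v' bs) = support v' cs"
proof -
  have v: "v \<in> verts Q" using p by auto
  obtain s cs where s: "awalk s cs v'" "v \<preceq> s"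
    and trunc: "support v' cs = {y \<in> support v' bs. v \<preceq> fst y}"
    using support_truncate[OF q less_imp_less_eq[OF less] v] by blast
  \<comment> \<open>The concatenations whose left factor is a nonempty suffix of
    \<open>as\<close>.\<close>
  let ?T = "{z. \<exists>x\<in>arrow_suffixes Q as. \<exists>ys. (v, ys) \<in> support v' cs \<and> z = (fst x, snd x @ ys)}"
  have target: "path_target Q x = v" if "x \<in> arrow_suffixes Q as" for x
    using that arrow_suffixes_awalk[OF p] path_target_awalk by (cases x) blast
  have *: "concat_set (support v as) (support v' bs) = support v' cs \<union> ?T"
  proof (intro equalityI subsetI)
    fix z assume "z \<in> concat_set (support v as) (support v' bs)"
    then obtain x y where xy: "x \<in> support v as" "y \<in> support v' bs" "fst y = path_target Q x"
      "z = (fst x, snd x @ snd y)"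
      by (auto simp: concat_set_def path_concat_def split: if_splits)
    show "z \<in> support v' cs \<union> ?T"
    proof (cases "x \<in> arrow_suffixes Q as")
      case True
      with xy target have "(v, snd y) \<in> support v' cs"
        unfolding trunc by (cases y) auto
      with True xy show ?thesis by blast
    next
      case False
      with xy have "snd x = []" "v \<preceq> fst x"
        by (auto simp: support_def)
      with xy have "z = y" "v \<preceq> fst y"
        by (auto simp: path_target_def prod_eq_iff)
      with xy trunc show ?thesis by auto
    qed
  next
    fix z assume "z \<in> support v' cs \<union> ?T"
    then show "z \<in> concat_set (support v as) (support v' bs)"
    proof
      assume "z \<in> support v' cs"
      then have z: "z \<in> support v' bs" "v \<preceq> fst z" "fst z \<in> verts Q"
        using trunc support_awalk[OF q, of "fst z" "snd z"] by auto
      then have "(fst z, []) \<in> support v as"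
        by (simp add: in_support_iff)
      moreover have "path_concat Q (fst z, []) z = Some z"
        by (simp add: path_concat_def path_target_def)
      ultimately show ?thesis
        using z unfolding concat_set_def by blast
    next
      assume "z \<in> ?T"
      then obtain x ys where x: "x \<in> arrow_suffixes Q as" "(v, ys) \<in> support v' cs"
        "z = (fst x, snd x @ ys)" by blast
      then have "path_concat Q x (v, ys) = Some z"
        by (simp add: path_concat_def target)
      with x show ?thesis
        unfolding concat_set_def trunc by (auto simp: support_def)
    qed
  qed
  show ?thesis
  proof (cases "s = v")
    case True
    \<comment> \<open>Here \<open>cs\<close> itself is the one member of its support that starts at
      \<open>v\<close>, so every suffix of \<open>as\<close> has exactly one extension.\<close>
    then have "?T = (\<lambda>x. (fst x, snd x @ cs)) ` arrow_suffixes Q as"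
      using self_in_support[OF s(1)] support_source_inj[OF s(1)] by auto
    then have "concat_set (support v as) (support v' bs) = support v' (as @ cs)"
      unfolding * by (auto simp: support_def arrow_suffixes_append)
    moreover have "awalk u (as @ cs) v'"
      using p s True by (blast intro: awalk_appendI)
    ultimately show ?thesis by blast
  next
    case False
    with s have "v \<prec> s" by (auto simp: less_eq_def)
    then have "?T = {}"
      using support_awalk[OF s(1)] less_eq_not_less by blast
    with * s show ?thesis by auto
  qed
qed

text \<open>A suffix of full length is the path itself, so any other suffix is shorter. A stationary
  member is shorter too unless \<open>p\<close> is itself stationary, and then it lies at a strictly
  larger vertex.\<close>

lemma wf_support:
  "wf {(p, x). p \<in> quiver_paths Q \<and> x \<in> support (path_target Q p) (snd p) \<and> x \<noteq> p}"
proof (rule wf_subset)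
  \<comment> \<open>Longer paths come first, and ties between stationary paths are broken by the
    number of smaller vertices. The natural subtraction does not truncate, as no path has more
    arrows than there are vertices.\<close>
  let ?M = "measures [\<lambda>p :: ('v, 'e) path. card (verts Q) - length (snd p), \<lambda>p. card {w \<in> verts Q. w \<prec> fst p}]"
  show "wf ?M" by simp
  show "{(p, x). p \<in> quiver_paths Q \<and> x \<in> support (path_target Q p) (snd p) \<and> x \<noteq> p} \<subseteq> ?M"
  proof (rule subrelI)
    fix p' x'
    assume "(p', x') \<in> {(p, x). p \<in> quiver_paths Q \<and> x \<in> support (path_target Q p) (snd p) \<and> x \<noteq> p}"
    moreover obtain u as w bs where eq: "p' = (u, as)" "x' = (w, bs)"
      by (cases p', cases x')
    ultimately have p: "(u, as) \<in> quiver_paths Q" and x: "(w, bs) \<in> support (path_target Q (u, as)) as"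
      and neq: "(w, bs) \<noteq> (u, as)"
      by auto
    obtain v where v: "awalk u as v" "path_target Q (u, as) = v"
      using p by (auto elim: quiver_pathsE)
    have "((u, as), (w, bs)) \<in> ?M"
    proof (cases "length bs < length as")
      case True
      with length_awalk_le_card_verts[OF v(1)] have "card (verts Q) - length as < card (verts Q) - length bs"
        by linarith
      then show ?thesis by simp
    next
      case False
      have "(w, bs) \<notin> arrow_suffixes Q as"
      proof
        assume bs: "(w, bs) \<in> arrow_suffixes Q as"
        with False have "(w, bs) = (tail Q (hd as), as)"
          using arrow_suffixes_shorter by fastforce
        moreover have "u = tail Q (hd as)"
          using v bs by (cases as) (auto simp: awalk_Cons_iff)
        ultimately show False using neq by simp
      qed
      with x v False have *: "bs = []" "as = []" "v \<preceq> w" "w \<in> verts Q"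
        by (auto simp: in_support_iff)
      with v neq have "u \<prec> w" "u \<in> verts Q"
        by (auto simp: awalk_Nil_iff less_eq_def)
      then have "{x \<in> verts Q. x \<prec> u} \<subset> {x \<in> verts Q. x \<prec> w}"
        using less_trans less_irrefl by blast
      then have "card {x \<in> verts Q. x \<prec> u} < card {x \<in> verts Q. x \<prec> w}"
        by (rule psubset_card_mono[rotated]) simp
      with * show ?thesis by simp
    qed
    then show "(p', x') \<in> ?M" unfolding eq .
  qed
qed

end

section \<open>The band of an ordered quiver\<close>

lemma finite_monoid_basis:
  assumes "cring R" "monoid M" "finite (carrier M)"
  shows "finite_multiplicative_basis R (carrier M) (\<lambda>x y. Some (x \<otimes>\<^bsub>M\<^esub> y)) {\<one>\<^bsub>M\<^esub>}"
proof -
  interpret M: monoid M by fact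
  show ?thesis
    by (intro finite_multiplicative_basis.intro assms(1) finite_multiplicative_basis_axioms.intro)
      (use assms in \<open>auto simp: M.m_assoc\<close>)
qed

locale ordered_quiver_ring = ordered_quiver Q prec + cring R
  for Q :: "('v, 'e) pre_digraph" and prec :: "'v rel" and R :: "('k, 'r) ring_scheme" (structure)
begin

text \<open>The unique left unit of a path is the stationary path at its source, the unique right
  unit the one at its target.\<close>

sublocale path_basis: finite_multiplicative_basis R "quiver_paths Q" "path_concat Q" "(\<lambda>v. (v, [])) ` verts Q"
proof unfold_locales
  show "finite (quiver_paths Q)" by (rule finite_quiver_paths)
  show "(\<lambda>v. (v, [])) ` verts Q \<subseteq> quiver_paths Q"
    by (auto intro!: quiver_pathsI simp: awalk_Nil_iff)
  show "z \<in> quiver_paths Q" if xyz: "x \<in> quiver_paths Q" "y \<in> quiver_paths Q" "path_concat Q x y = Some z" for x y z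
  proof -
    obtain u as v where x: "x = (u, as)" "awalk u as v" "path_target Q x = v"
      using xyz(1) by (rule quiver_pathsE)
    obtain u' bs v' where y: "y = (u', bs)" "awalk u' bs v'"
      using xyz(2) by (rule quiver_pathsE)
    have "u' = v" "z = (u, as @ bs)"
      using xyz(3) x y by (auto simp: path_concat_def split: if_splits)
    with x y show ?thesis
      by (auto intro!: quiver_pathsI awalk_appendI simp del: awalk_append_iff)
  qed
  show "\<exists>!e. e \<in> (\<lambda>v. (v, [])) ` verts Q \<and> path_concat Q e x \<noteq> None"
    and "\<exists>!e. e \<in> (\<lambda>v. (v, [])) ` verts Q \<and> path_concat Q x e \<noteq> None" if x: "x \<in> quiver_paths Q" for x
  proof -
    obtain u as v where v: "x = (u, as)" "awalk u as v" "path_target Q x = v"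
      using x by (rule quiver_pathsE)
    have target: "path_target Q (w, []) = w" for w
      by (simp add: path_target_def)
    show "\<exists>!e. e \<in> (\<lambda>v. (v, [])) ` verts Q \<and> path_concat Q e x \<noteq> None"
      by (rule ex1I[of _ "(u, [])"]) (use v in \<open>auto simp: path_concat_def target split: if_splits\<close>)
    show "\<exists>!e. e \<in> (\<lambda>v. (v, [])) ` verts Q \<and> path_concat Q x e \<noteq> None"
      by (rule ex1I[of _ "(v, [])"]) (use v in \<open>auto simp: path_concat_def split: if_splits\<close>)
  qed
qed (auto simp: path_concat_assoc path_concat_def path_target_def split: if_splits)

section \<open>The band elements and their products\<close>

abbreviation PA where "PA \<equiv> path_algebra R Q"

abbreviation path_support where "path_support p \<equiv> support (path_target Q p) (snd p)"

abbreviation vec where "vec \<equiv> set_vector R (quiver_paths Q)"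

lemma path_support_subset:
  assumes "p \<in> quiver_paths Q"
  shows "path_support p \<subseteq> quiver_paths Q"
proof -
  obtain u as v where "p = (u, as)" "awalk u as v" "path_target Q p = v"
    using assms by (rule quiver_pathsE)
  with support_subset show ?thesis by simp
qed

text \<open>No basis path is repeated in the two sums of \<open>ell\<close>: the first has
  stationary paths at distinct vertices, the second nonempty paths of distinct lengths.\<close>

lemma ell_eq_set_vector:
  assumes p: "p \<in> quiver_paths Q"
  shows "ell R Q prec p = vec (path_support p)"
proof -
  let ?E = "(\<lambda>w. (w, [])) ` {w \<in> verts Q. path_target Q p \<preceq> w}"
  let ?S = "arrow_suffixes Q (snd p)"
  interpret A: abelian_group PA
    unfolding path_algebra_def by (rule path_basis.A_abelian_group)
  have E: "?E \<subseteq> quiver_paths Q" and S: "?S \<subseteq> quiver_paths Q"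
    using path_support_subset[OF p] by (auto simp: support_def)
  have vec: "finsum PA (path_vector R Q) T = vec T" if "T \<subseteq> quiver_paths Q" for T
    using path_basis.finsum_basis_vector[OF that] by (simp add: path_algebra_def)
  have closed: "path_vector R Q x \<in> carrier PA" for x
    using path_basis.basis_vector_closed by (simp add: path_algebra_def)
  have "(\<Oplus>\<^bsub>PA\<^esub>u\<in>{u \<in> verts Q. path_target Q p \<preceq> u}. path_vector R Q (u, [])) = vec ?E"
    by (subst vec[OF E, symmetric], subst A.finsum_reindex) (auto simp: closed inj_on_def)
  moreover have "inj_on (\<lambda>i. (tail Q (snd p ! i), drop i (snd p))) {..<length (snd p)}"
  proof (rule inj_onI)
    fix i j assume ij: "i \<in> {..<length (snd p)}" "j \<in> {..<length (snd p)}"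
      and "(tail Q (snd p ! i), drop i (snd p)) = (tail Q (snd p ! j), drop j (snd p))"
    then have "length (drop i (snd p)) = length (drop j (snd p))" by simp
    with ij show "i = j" by simp
  qed
  then have "(\<Oplus>\<^bsub>PA\<^esub>i\<in>{..<length (snd p)}. path_vector R Q (tail Q (snd p ! i), drop i (snd p))) = vec ?S"
    by (subst vec[OF S, symmetric], subst arrow_suffixes_conv, subst A.finsum_reindex) (auto simp: closed)
  moreover have "?E \<inter> ?S = {}"
    using arrow_suffixes_nonempty by fastforce
  ultimately show ?thesis
    unfolding ell_def support_def path_basis.set_vector_Un[symmetric, OF \<open>?E \<inter> ?S = {}\<close>]
    by (simp add: path_algebra_def less_eq_def eq_commute)
qed

text \<open>A concatenation has the source of its left factor, and the first support has at most one
  path with that source. So the left factor is determined, and with it the source and the arrows of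
  the right factor.\<close>

lemma set_vector_support_mult:
  assumes p: "awalk u as v" and q: "awalk u' bs v'"
  shows "vec (support v as) \<otimes>\<^bsub>PA\<^esub> vec (support v' bs) = vec (concat_set (support v as) (support v' bs))"
  unfolding path_algebra_def concat_set_def
proof (rule path_basis.set_vector_mult)
  show "support v as \<subseteq> quiver_paths Q" "support v' bs \<subseteq> quiver_paths Q"
    using p q by (simp_all add: support_subset)
  fix x y x' y' z
  assume S: "x \<in> support v as" "x' \<in> support v as"
    and "path_concat Q x y = Some z" "path_concat Q x' y' = Some z"
  then have z: "z = (fst x, snd x @ snd y)" "z = (fst x', snd x' @ snd y')"
    "fst y = path_target Q x" "fst y' = path_target Q x'"
    by (auto simp: path_concat_def split: if_splits)
  then have "fst x = fst x'" by simp
  then have "(fst x, snd x) \<in> support v as" "(fst x, snd x') \<in> support v as"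
    using S by (metis prod.collapse)+
  from support_source_inj[OF p this] \<open>fst x = fst x'\<close> have "x = x'"
    by (simp add: prod_eq_iff)
  with z show "x = x' \<and> y = y'"
    by (simp add: prod_eq_iff)
qed

lemma ell_mult_absorb:
  assumes p: "p \<in> quiver_paths Q" and q: "q \<in> quiver_paths Q"
    and le: "path_target Q q \<preceq> path_target Q p"
  shows "ell R Q prec p \<otimes>\<^bsub>PA\<^esub> ell R Q prec q = ell R Q prec p"
proof -
  obtain u as v where u: "p = (u, as)" "awalk u as v" "path_target Q p = v"
    using p by (rule quiver_pathsE)
  obtain u' bs v' where u': "q = (u', bs)" "awalk u' bs v'" "path_target Q q = v'"
    using q by (rule quiver_pathsE)
  show ?thesis
    unfolding ell_eq_set_vector[OF p] ell_eq_set_vector[OF q]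
    using set_vector_support_mult[OF u(2) u'(2)] concat_set_support_absorb[OF u(2) u'(2)] le u u'
    by simp
qed

lemma ell_mult_less:
  assumes p: "p \<in> quiver_paths Q" and q: "q \<in> quiver_paths Q"
    and less: "path_target Q p \<prec> path_target Q q"
  shows "\<exists>r\<in>quiver_paths Q. path_target Q r = path_target Q q
    \<and> ell R Q prec p \<otimes>\<^bsub>PA\<^esub> ell R Q prec q = ell R Q prec r"
proof -
  obtain u as v where u: "p = (u, as)" "awalk u as v" "path_target Q p = v"
    using p by (rule quiver_pathsE)
  obtain u' bs v' where u': "q = (u', bs)" "awalk u' bs v'" "path_target Q q = v'"
    using q by (rule quiver_pathsE)
  obtain s cs where s: "awalk s cs v'"
    and "concat_set (support v as) (support v' bs) = support v' cs"
    using concat_set_support_less[OF u(2) u'(2)] less u u' by auto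
  moreover have "path_target Q (s, cs) = v'"
    using s by (rule path_target_awalk)
  ultimately have "path_target Q (s, cs) = path_target Q q
    \<and> ell R Q prec p \<otimes>\<^bsub>PA\<^esub> ell R Q prec q = ell R Q prec (s, cs)"
    using p q u u' quiver_pathsI[OF s] set_vector_support_mult[OF u(2) u'(2)]
    by (simp add: ell_eq_set_vector)
  with quiver_pathsI[OF s] show ?thesis by blast
qed

text \<open>Totality of the order leaves the two cases \<open>ell_mult_less\<close> and
  \<open>ell_mult_absorb\<close>. The bound on the target of \<open>r\<close> is recorded because
  the left regular law rests on it.\<close>

lemma ell_mult:
  assumes p: "p \<in> quiver_paths Q" and q: "q \<in> quiver_paths Q"
  shows "\<exists>r\<in>quiver_paths Q. path_target Q p \<preceq> path_target Q r
    \<and> ell R Q prec p \<otimes>\<^bsub>PA\<^esub> ell R Q prec q = ell R Q prec r"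
proof -
  have "path_target Q p \<in> verts Q" "path_target Q q \<in> verts Q"
    using p q by (auto elim!: quiver_pathsE)
  from less_total[OF this] show ?thesis
  proof
    assume "path_target Q p \<prec> path_target Q q"
    then have "path_target Q p \<preceq> path_target Q q"
      by (rule less_imp_less_eq)
    moreover obtain r where "r \<in> quiver_paths Q" "path_target Q r = path_target Q q"
      "ell R Q prec p \<otimes>\<^bsub>PA\<^esub> ell R Q prec q = ell R Q prec r"
      using ell_mult_less[OF p q \<open>path_target Q p \<prec> path_target Q q\<close>] by blast
    ultimately show ?thesis by metis
  next
    assume "path_target Q q \<preceq> path_target Q p"
    with ell_mult_absorb[OF p q] p show ?thesis
      using less_eq_refl by blast
  qed
qed

text \<open>At the smallest vertex \<open>v\<close>, the support of the stationary path consists of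
  all stationary paths, whose sum is the unit.\<close>

lemma one_in_quiver_band_set:
  assumes "verts Q \<noteq> {}"
  shows "\<one>\<^bsub>PA\<^esub> \<in> quiver_band_set R Q prec"
proof -
  \<comment> \<open>\<open>prec\<close> may also relate elements that are not vertices; its
    restriction to the vertices is finite.\<close>
  have "wf {(p, x) \<in> prec. p \<in> verts Q \<and> x \<in> verts Q}" (is "wf ?r")
  proof (rule finite_acyclic_wf)
    show "finite ?r"
      by (rule finite_subset[of _ "verts Q \<times> verts Q"]) auto
    have "trans ?r"
      by (rule transI) (auto dest: less_trans)
    then show "acyclic ?r"
      by (intro acyclicI) (auto simp: less_irrefl)
  qed
  then obtain v where v: "v \<in> verts Q" and "\<And>w. (w, v) \<in> ?r \<Longrightarrow> w \<notin> verts Q"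
  proof (rule wfE_min'[OF _ assms])
    fix z assume "z \<in> verts Q" "\<And>w. (w, z) \<in> ?r \<Longrightarrow> w \<notin> verts Q"
    then show thesis by (rule that)
  qed
  then have "v \<preceq> w" if "w \<in> verts Q" for w
    using less_total[OF that v] that v by blast
  then have "{w \<in> verts Q. v \<preceq> w} = verts Q" by blast
  moreover have path: "(v, []) \<in> quiver_paths Q"
    using v by (auto intro: quiver_pathsI simp: awalk_Nil_iff)
  ultimately have "ell R Q prec (v, []) = \<one>\<^bsub>PA\<^esub>"
    by (simp add: ell_eq_set_vector path_algebra_def path_basis.one_eq_set_vector support_def path_target_def)
  with path show ?thesis
    unfolding quiver_band_set_def by (metis image_eqI)
qed

lemma left_regular_band_quiver_band:
  assumes "verts Q \<noteq> {}"
  shows "left_regular_band (quiver_band R Q prec)"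
proof -
  interpret A: assoc_algebra R PA
    unfolding path_algebra_def by (rule path_basis.A_assoc_algebra)
  have B_subset: "quiver_band_set R Q prec \<subseteq> carrier PA"
    by (auto simp: quiver_band_set_def ell_eq_set_vector path_algebra_def)
  have B_mult: "x \<otimes>\<^bsub>PA\<^esub> y \<in> quiver_band_set R Q prec"
    if "x \<in> quiver_band_set R Q prec" "y \<in> quiver_band_set R Q prec" for x y
    using that ell_mult unfolding quiver_band_set_def by fastforce
  show ?thesis
  proof (intro left_regular_band.intro monoidI left_regular_band_axioms.intro)
    fix x y assume x: "x \<in> carrier (quiver_band R Q prec)" and y: "y \<in> carrier (quiver_band R Q prec)"
    then show "x \<otimes>\<^bsub>quiver_band R Q prec\<^esub> y \<in> carrier (quiver_band R Q prec)"
      by (simp add: quiver_band_def B_mult)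
    obtain p where p: "p \<in> quiver_paths Q" "x = ell R Q prec p"
      using x by (auto simp: quiver_band_def quiver_band_set_def)
    obtain q where q: "q \<in> quiver_paths Q" "y = ell R Q prec q"
      using y by (auto simp: quiver_band_def quiver_band_set_def)
    \<comment> \<open>Since the target of \<open>r\<close> is weakly above that of \<open>p\<close>,
      \<open>ell_mult_absorb\<close> for \<open>r\<close> and \<open>p\<close> gives
      \<open>x y x = x y\<close>.\<close>
    obtain r where "r \<in> quiver_paths Q" "path_target Q p \<preceq> path_target Q r" "x \<otimes>\<^bsub>PA\<^esub> y = ell R Q prec r"
      using ell_mult p q by blast
    with p ell_mult_absorb
    show "x \<otimes>\<^bsub>quiver_band R Q prec\<^esub> y \<otimes>\<^bsub>quiver_band R Q prec\<^esub> x = x \<otimes>\<^bsub>quiver_band R Q prec\<^esub> y"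
      by (simp add: quiver_band_def)
  next
    fix x assume "x \<in> carrier (quiver_band R Q prec)"
    then show "x \<otimes>\<^bsub>quiver_band R Q prec\<^esub> x = x"
      by (auto simp: quiver_band_def quiver_band_set_def ell_mult_absorb)
  qed (use B_subset one_in_quiver_band_set[OF assms] in
      \<open>auto simp: quiver_band_def A.m_assoc subset_iff\<close>)
qed

section \<open>The band as a basis of the path algebra\<close>

lemma bij_betw_linear_extension_quiver_band:
  "bij_betw (linear_extension R (quiver_band_set R Q prec) PA (\<lambda>b. b))
    (quiver_band_set R Q prec \<rightarrow>\<^sub>E carrier R) (carrier PA)"
\<comment> \<open>Over the zero ring domain and codomain are singletons. Otherwise the triangular
  criterion applies with the order of \<open>wf_support\<close>.\<close>
proof (cases "\<one> = \<zero>")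
  case True
  then have R: "carrier R = {\<zero>}"
    using carrier_one_zero by simp
  interpret A: assoc_algebra R PA
    unfolding path_algebra_def by (rule path_basis.A_assoc_algebra)
  have PA: "carrier PA = {\<zero>\<^bsub>PA\<^esub>}"
  proof (intro equalityI subsetI)
    fix f assume "f \<in> carrier PA"
    then have f: "f \<in> carrier path_basis.A"
      by (simp add: path_algebra_def)
    have "f = \<zero>\<^bsub>path_basis.A\<^esub>"
    proof (rule path_basis.A_eqI[OF f path_basis.A_closed(1)])
      fix x assume x: "x \<in> quiver_paths Q"
      then show "f x = \<zero>\<^bsub>path_basis.A\<^esub> x"
        using path_basis.A_apply_closed[OF f x] R by (simp add: path_basis.A_zero_apply)
    qed
    then have "f = \<zero>\<^bsub>PA\<^esub>"
      by (simp add: path_algebra_def)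
    then show "f \<in> {\<zero>\<^bsub>PA\<^esub>}" by simp
  qed simp
  have "linear_extension R (quiver_band_set R Q prec) PA (\<lambda>b. b) f = \<zero>\<^bsub>PA\<^esub>"
    if "f \<in> quiver_band_set R Q prec \<rightarrow>\<^sub>E carrier R" for f
  proof -
    have empty: "{x \<in> quiver_band_set R Q prec. f x \<noteq> \<zero>} = {}"
      using that R by auto
    show ?thesis unfolding linear_extension_def empty by simp
  qed
  then show ?thesis
    unfolding PA R by (auto simp: bij_betw_def inj_on_def intro: PiE_ext)
next
  case False
  have "quiver_band_set R Q prec = (\<lambda>p. vec (path_support p)) ` quiver_paths Q"
    unfolding quiver_band_set_def by (rule image_cong) (simp_all add: ell_eq_set_vector)
  moreover have "p \<in> path_support p" if "p \<in> quiver_paths Q" for p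
    using that self_in_support by (auto elim!: quiver_pathsE)
  ultimately show ?thesis
    using path_basis.bij_betw_linear_extension_unitriangular[OF False _ wf_support]
    by (simp add: path_algebra_def)
qed

text \<open>The band inherits product and unit from the path algebra, so the inclusion meets the
  conditions of \<open>linear_extension_hom\<close>; bijectivity is the basis property.\<close>

lemma assoc_algebra_iso_quiver_band:
  assumes "verts Q \<noteq> {}"
  shows "assoc_algebra_iso R (monoid_algebra R (quiver_band R Q prec)) PA
    (linear_extension R (quiver_band_set R Q prec) PA (\<lambda>b. b))"
proof -
  let ?B = "quiver_band R Q prec"
  let ?h = "linear_extension R (quiver_band_set R Q prec) PA (\<lambda>b. b)"
  interpret B: left_regular_band ?B
    by (rule left_regular_band_quiver_band[OF assms])
  have A: "assoc_algebra R PA"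
    unfolding path_algebra_def by (rule path_basis.A_assoc_algebra)
  interpret A: assoc_algebra R PA by (rule A)
  have carrier_B: "carrier ?B = quiver_band_set R Q prec"
    by (simp add: quiver_band_def)
  have "finite (carrier ?B)"
    by (simp add: carrier_B quiver_band_set_def finite_quiver_paths)
  then interpret MB: finite_multiplicative_basis R "quiver_band_set R Q prec"
      "\<lambda>x y. Some (x \<otimes>\<^bsub>?B\<^esub> y)" "{\<one>\<^bsub>?B\<^esub>}"
    using finite_monoid_basis[OF is_cring B.monoid_axioms] by (simp add: carrier_B)
  have MB: "monoid_algebra R ?B = MB.A"
    by (simp add: monoid_algebra_def carrier_B)
  have B_closed: "(\<lambda>b. b) \<in> quiver_band_set R Q prec \<rightarrow> carrier PA"
    by (auto simp: quiver_band_set_def ell_eq_set_vector path_algebra_def)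
  note hom = MB.linear_extension_hom[OF A B_closed]
  show ?thesis
    unfolding MB
  proof (intro assoc_algebra_iso.intro MB.A_assoc_algebra A assoc_algebra_iso_axioms.intro)
    have "?h \<in> ring_hom MB.A PA"
      by (rule hom) (simp_all add: quiver_band_def)
    then show "?h \<in> ring_iso MB.A PA"
      using bij_betw_linear_extension_quiver_band by (simp add: ring_iso_def MB.carrier_A)
    fix a f assume "a \<in> carrier R" "f \<in> carrier MB.A"
    then show "?h (a \<odot>\<^bsub>MB.A\<^esub> f) = a \<odot>\<^bsub>PA\<^esub> ?h f"
      by (intro hom(2)) (simp_all add: quiver_band_def)
  qed
qed

end

theorem theorem3p10:
  fixes R :: "('k, 'r) ring_scheme"
    and Q :: "('v, 'e) pre_digraph"
    and prec :: "'v rel"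
  assumes "cring R"
    and "fin_digraph Q"
    and "verts Q \<noteq> {}"
    and "\<nexists>c. pre_digraph.cycle Q c"
    and "strict_linear_order_on (verts Q) prec"
    and "\<And>e. e \<in> arcs Q \<Longrightarrow> (tail Q e, head Q e) \<in> prec"
  shows "left_regular_band (quiver_band R Q prec)
    \<and> assoc_algebra_iso R (monoid_algebra R (quiver_band R Q prec)) (path_algebra R Q)
        (linear_extension R (quiver_band_set R Q prec) (path_algebra R Q) (\<lambda>b. b))"
proof -
  interpret ordered_quiver_ring Q prec R
    using assms by (intro ordered_quiver_ring.intro ordered_quiver.intro ordered_quiver_axioms.intro)
  show ?thesis
    using left_regular_band_quiver_band[OF assms(3)] assoc_algebra_iso_quiver_band[OF assms(3)] by blast
qed

end
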